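(* Let $n\geq 5$ and let $h:UVB_n\to S_n$ be any group homomorphism. Then, up to conjugation, one of the following holds: (1) $h$ is the homomorphism $\phi$; (2) $h$ is Abelian; (3) $n=6$ and $h$ is $v_6\circ\phi$.
   Context: The unrestricted virtual braid group $UVB_n$ is the group with generators $\sigma_1,\dots,\sigma_{n-1},\rho_1,\dots,\rho_{n-1}$ and relations: $\sigma_i\sigma_{i+1}\sigma_i=\sigma_{i+1}\sigma_i\sigma_{i+1}$ ($1\le i\le n-2$); $\sigma_i\sigma_j=\sigma_j\sigma_i$ ($|i-j|>1$); $\rho_i\rho_{i+1}\rho_i=\rho_{i+1}\rho_i\rho_{i+1}$ ($1\le i\le n-2$); $\rho_i\rho_j=\rho_j\rho_i$ ($|i-j|>1$); $\rho_i^2=1$ ($1\le i\le n-1$); $\sigma_i\rho_j=\rho_j\sigma_i$ ($|i-j|>1$); $\sigma_i\rho_{i+1}\rho_i=\rho_{i+1}\rho_i\sigma_{i+1}$ ($1\le i\le n-2$); $\rho_i\sigma_{i+1}\sigma_i=\sigma_{i+1}\sigma_i\rho_{i+1}$ ($1\le i\le n-2$); $\rho_{i+1}\sigma_i\sigma_{i+1}=\sigma_i\sigma_{i+1}\rho_i$ ($1\le i\le n-2$). $S_n$ is the symmetric group of degree $n$. The homomorphism $\phi:UVB_n\to S_n$ is defined by $\phi(\sigma_i)=\phi(\rho_i)=(i,i+1)$ for $1\le i\le n-1$. $v_6$ denotes the outer (i.e. non-inner) automorphism of $S_6$ (unique up to composition with inner automorphisms). Two homomorphisms $h_1,h_2:G\to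 H$ are conjugate if there is $x\in H$ with $h_2(g)=xh_1(g)x^{-1}$ for all $g\in G$; "up to conjugation" means after replacing $h$ by a conjugate homomorphism. A homomorphism $h:G\to H$ is Abelian if $h(G)$ is an Abelian subgroup of $H$. *)

theory Defs
  imports "HOL-Algebra.Sym_Groups"
begin

section \<open>Groups given by generators and relations\<close>

datatype 'a letter = Gen (base: 'a) | Inv (base: 'a)

type_synonym 'a word = "'a letter list"

definition words :: "'a set \<Rightarrow> 'a word set" where
  "words X = lists {l. base l \<in> X}"

text \<open>A pair \<open>(r, s) \<in> R\<close> stands for the relation \<open>r = s\<close>.\<close>

inductive_set pres_rel :: "'a set \<Rightarrow> ('a word \<times> 'a word) set \<Rightarrow> ('a word \<times> 'a word) set"
  for X R where
  refl: "w \<in> words X \<Longrightarrow> (w, w) \<in> pres_rel X R"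
| sym: "(v, w) \<in> pres_rel X R \<Longrightarrow> (w, v) \<in> pres_rel X R"
| trans: "(u, v) \<in> pres_rel X R \<Longrightarrow> (v, w) \<in> pres_rel X R \<Longrightarrow> (u, w) \<in> pres_rel X R"
| gen_inv: "x \<in> X \<Longrightarrow> u \<in> words X \<Longrightarrow> v \<in> words X \<Longrightarrow>
    (u @ [Gen x, Inv x] @ v, u @ v) \<in> pres_rel X R"
| inv_gen: "x \<in> X \<Longrightarrow> u \<in> words X \<Longrightarrow> v \<in> words X \<Longrightarrow>
    (u @ [Inv x, Gen x] @ v, u @ v) \<in> pres_rel X R"
| relation: "(r, s) \<in> R \<Longrightarrow> r \<in> words X \<Longrightarrow> s \<in> words X \<Longrightarrow> u \<in> words X \<Longrightarrow> v \<in> words X \<Longrightarrow>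
    (u @ r @ v, u @ s @ v) \<in> pres_rel X R"

definition presented_group :: "'a set \<Rightarrow> ('a word \<times> 'a word) set \<Rightarrow> 'a word set monoid" where
  "presented_group X R = \<lparr>carrier = words X // pres_rel X R,
     mult = (\<lambda>A B. \<Union>a\<in>A. \<Union>b\<in>B. pres_rel X R `` {a @ b}),
     one = pres_rel X R `` {[]}\<rparr>"

definition pres_gen :: "'a set \<Rightarrow> ('a word \<times> 'a word) set \<Rightarrow> 'a \<Rightarrow> 'a word set" where
  "pres_gen X R x = pres_rel X R `` {[Gen x]}"

fun eval_word :: "('b, 'c) monoid_scheme \<Rightarrow> ('a \<Rightarrow> 'b) \<Rightarrow> 'a word \<Rightarrow> 'b" where
  "eval_word G f [] = \<one>\<^bsub>G\<^esub>"
| "eval_word G f (Gen x # w) = f x \<otimes>\<^bsub>G\<^esub> eval_word G f w"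
| "eval_word G f (Inv x # w) = inv\<^bsub>G\<^esub> f x \<otimes>\<^bsub>G\<^esub> eval_word G f w"

text \<open>The map on the presented group induced by an assignment of the generators. It does not
  depend on the chosen representatives when the assignment satisfies the relations.\<close>

definition pres_lift :: "('b, 'c) monoid_scheme \<Rightarrow> ('a \<Rightarrow> 'b) \<Rightarrow> 'a word set \<Rightarrow> 'b" where
  "pres_lift G f A = eval_word G f (SOME w. w \<in> A)"

lemma words_simps [simp]:
  "[] \<in> words X"
  "l # w \<in> words X \<longleftrightarrow> base l \<in> X \<and> w \<in> words X"
  "v @ w \<in> words X \<longleftrightarrow> v \<in> words X \<and> w \<in> words X"
  by (auto simp: words_def)

lemma pres_rel_words: "(v, w) \<in> pres_rel X R \<Longrightarrow> v \<in> words X \<and> w \<in> words X"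
  by (induction rule: pres_rel.induct) auto

lemma equiv_pres_rel: "equiv (words X) (pres_rel X R)"
proof (rule equivI)
  show "pres_rel X R \<subseteq> words X \<times> words X"
    using pres_rel_words by fast
  show "refl_on (words X) (pres_rel X R)"
    by (auto simp: refl_on_def intro: pres_rel.refl)
  show "sym (pres_rel X R)" by (auto intro: symI pres_rel.sym)
  show "trans (pres_rel X R)" by (auto intro: transI pres_rel.trans)
qed

lemma pres_rel_context:
  assumes "(v, w) \<in> pres_rel X R" "a \<in> words X" "b \<in> words X"
  shows "(a @ v @ b, a @ w @ b) \<in> pres_rel X R"
  using assms
proof (induction rule: pres_rel.induct)
  case (refl w)
  then show ?case by (intro pres_rel.refl) auto
next
  case (sym v w)
  then show ?case by (blast intro: pres_rel.sym)
next
  case (trans u v w)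
  then show ?case by (blast intro: pres_rel.trans)
next
  case (gen_inv x u v)
  then show ?case using pres_rel.gen_inv[of x X "a @ u" "v @ b" R] by simp
next
  case (inv_gen x u v)
  then show ?case using pres_rel.inv_gen[of x X "a @ u" "v @ b" R] by simp
next
  case (relation r s u v)
  then show ?case using pres_rel.relation[of r s R X "a @ u" "v @ b"] by simp
qed

lemma pres_rel_append:
  assumes "(v, v') \<in> pres_rel X R" "(w, w') \<in> pres_rel X R"
  shows "(v @ w, v' @ w') \<in> pres_rel X R"
proof -
  have "(v @ w, v' @ w) \<in> pres_rel X R"
    using pres_rel_context[OF assms(1), of "[]" w] pres_rel_words[OF assms(2)] by simp
  moreover have "(v' @ w, v' @ w') \<in> pres_rel X R"
    using pres_rel_context[OF assms(2), of v' "[]"] pres_rel_words[OF assms(1)] by simp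
  ultimately show ?thesis by (rule pres_rel.trans)
qed

lemma pres_class_eq_iff:
  assumes "v \<in> words X" "w \<in> words X"
  shows "pres_rel X R `` {v} = pres_rel X R `` {w} \<longleftrightarrow> (v, w) \<in> pres_rel X R"
  using eq_equiv_class_iff[OF equiv_pres_rel assms] by simp

lemma presented_group_mult:
  assumes "v \<in> words X" "w \<in> words X"
  shows "pres_rel X R `` {v} \<otimes>\<^bsub>presented_group X R\<^esub> pres_rel X R `` {w} = pres_rel X R `` {v @ w}"
proof -
  let ?r = "pres_rel X R"
  have eq: "?r `` {a @ b} = ?r `` {v @ w}" if "a \<in> ?r `` {v}" "b \<in> ?r `` {w}" for a b
  proof -
    have "(v @ w, a @ b) \<in> ?r" using that by (intro pres_rel_append) simp_all
    from equiv_class_eq[OF equiv_pres_rel this] show ?thesis by simp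
  qed
  have "v \<in> ?r `` {v}" "w \<in> ?r `` {w}"
    using assms by (simp_all add: pres_rel.refl)
  with eq have "(\<Union>a\<in>?r `` {v}. \<Union>b\<in>?r `` {w}. ?r `` {a @ b}) = ?r `` {v @ w}"
    by blast
  then show ?thesis by (simp add: presented_group_def)
qed

lemma presented_group_carrierE:
  assumes "A \<in> carrier (presented_group X R)"
  obtains w where "w \<in> words X" "A = pres_rel X R `` {w}"
proof -
  have "A \<in> words X // pres_rel X R" using assms by (simp add: presented_group_def)
  then show ?thesis by (rule quotientE) (rule that)
qed

lemma presented_group_carrierI:
  "w \<in> words X \<Longrightarrow> pres_rel X R `` {w} \<in> carrier (presented_group X R)"
  by (simp add: presented_group_def quotientI)

lemma presented_group_one: "\<one>\<^bsub>presented_group X R\<^esub> = pres_rel X R `` {[]}"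
  by (simp add: presented_group_def)

lemma pres_rel_left_inverse: "w \<in> words X \<Longrightarrow> \<exists>v\<in>words X. (v @ w, []) \<in> pres_rel X R"
proof (induction w)
  case Nil
  then show ?case by (intro bexI[of _ "[]"]) (auto intro: pres_rel.refl)
next
  case (Cons l w)
  then obtain v where v: "v \<in> words X" "(v @ w, []) \<in> pres_rel X R" by auto
  show ?case
  proof (cases l)
    case (Gen x)
    with v(1) Cons.prems have "(v @ [Inv x, Gen x] @ w, v @ w) \<in> pres_rel X R"
      by (intro pres_rel.inv_gen) simp_all
    from pres_rel.trans[OF this v(2)] have "((v @ [Inv x]) @ l # w, []) \<in> pres_rel X R"
      using Gen by simp
    then show ?thesis using v Gen Cons.prems by (intro bexI[of _ "v @ [Inv x]"]) simp_all
  next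
    case (Inv x)
    with v(1) Cons.prems have "(v @ [Gen x, Inv x] @ w, v @ w) \<in> pres_rel X R"
      by (intro pres_rel.gen_inv) simp_all
    from pres_rel.trans[OF this v(2)] have "((v @ [Gen x]) @ l # w, []) \<in> pres_rel X R"
      using Inv by simp
    then show ?thesis using v Inv Cons.prems by (intro bexI[of _ "v @ [Gen x]"]) simp_all
  qed
qed

lemma group_presented_group: "group (presented_group X R)"
proof (rule groupI)
  fix A assume "A \<in> carrier (presented_group X R)"
  then obtain w where w: "w \<in> words X" "A = pres_rel X R `` {w}"
    by (rule presented_group_carrierE)
  then obtain v where v: "v \<in> words X" "(v @ w, []) \<in> pres_rel X R"
    using pres_rel_left_inverse by blast
  show "\<exists>B\<in>carrier (presented_group X R). B \<otimes>\<^bsub>presented_group X R\<^esub> A = \<one>\<^bsub>presented_group X R\<^esub>"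
    using v w by (intro bexI[of _ "pres_rel X R `` {v}"])
      (simp_all add: presented_group_mult presented_group_one pres_class_eq_iff presented_group_carrierI)
  show "\<one>\<^bsub>presented_group X R\<^esub> \<otimes>\<^bsub>presented_group X R\<^esub> A = A"
    using w by (simp add: presented_group_mult presented_group_one)
next
  fix A B assume AB: "A \<in> carrier (presented_group X R)" "B \<in> carrier (presented_group X R)"
  from AB(1) obtain v where v: "v \<in> words X" "A = pres_rel X R `` {v}"
    by (rule presented_group_carrierE)
  from AB(2) obtain w where w: "w \<in> words X" "B = pres_rel X R `` {w}"
    by (rule presented_group_carrierE)
  from v w show "A \<otimes>\<^bsub>presented_group X R\<^esub> B \<in> carrier (presented_group X R)"
    by (simp add: presented_group_mult presented_group_carrierI)
  fix C assume "C \<in> carrier (presented_group X R)"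
  then obtain u where "u \<in> words X" "C = pres_rel X R `` {u}"
    by (rule presented_group_carrierE)
  with v w show "A \<otimes>\<^bsub>presented_group X R\<^esub> B \<otimes>\<^bsub>presented_group X R\<^esub> C =
      A \<otimes>\<^bsub>presented_group X R\<^esub> (B \<otimes>\<^bsub>presented_group X R\<^esub> C)"
    by (simp add: presented_group_mult)
next
  show "\<one>\<^bsub>presented_group X R\<^esub> \<in> carrier (presented_group X R)"
    by (simp add: presented_group_one presented_group_carrierI)
qed

lemma (in group) eval_word_closed:
  assumes "f \<in> X \<rightarrow> carrier G"
  shows "w \<in> words X \<Longrightarrow> eval_word G f w \<in> carrier G"
proof (induction w)
  case (Cons l w)
  then have "f (base l) \<in> carrier G" "eval_word G f w \<in> carrier G"
    using assms by (simp_all add: Pi_iff)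
  then show ?case by (cases l) simp_all
qed simp

lemma (in group) eval_word_append:
  assumes "f \<in> X \<rightarrow> carrier G" "v \<in> words X" "w \<in> words X"
  shows "eval_word G f (v @ w) = eval_word G f v \<otimes> eval_word G f w"
  using assms(2)
proof (induction v)
  case Nil
  then show ?case using eval_word_closed[OF assms(1,3)] by simp
next
  case (Cons l v)
  then have "f (base l) \<in> carrier G" "eval_word G f v \<in> carrier G" "eval_word G f w \<in> carrier G"
    using assms eval_word_closed[OF assms(1)] by (simp_all add: Pi_iff)
  with Cons show ?case by (cases l) (simp_all add: m_assoc)
qed

lemma (in group) eval_word_respects:
  assumes f: "f \<in> X \<rightarrow> carrier G"
    and R: "\<And>r s. (r, s) \<in> R \<Longrightarrow> r \<in> words X \<Longrightarrow> s \<in> words X \<Longrightarrow> eval_word G f r = eval_word G f s"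
    and "(v, w) \<in> pres_rel X R"
  shows "eval_word G f v = eval_word G f w"
  using assms(3)
proof (induction rule: pres_rel.induct)
  case (gen_inv x u v)
  then have "f x \<in> carrier G" "eval_word G f v \<in> carrier G"
    using f eval_word_closed[OF f] by (simp_all add: Pi_iff)
  then have "eval_word G f ([Gen x, Inv x] @ v) = eval_word G f v"
    by (simp add: m_assoc [symmetric])
  with gen_inv show ?case
    using eval_word_append[OF f, of u v] eval_word_append[OF f, of u "[Gen x, Inv x] @ v"] by simp
next
  case (inv_gen x u v)
  then have "f x \<in> carrier G" "eval_word G f v \<in> carrier G"
    using f eval_word_closed[OF f] by (simp_all add: Pi_iff)
  then have "eval_word G f ([Inv x, Gen x] @ v) = eval_word G f v"
    by (simp add: m_assoc [symmetric])
  with inv_gen show ?case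
    using eval_word_append[OF f, of u v] eval_word_append[OF f, of u "[Inv x, Gen x] @ v"] by simp
next
  case (relation r s u v)
  then show ?case
    using R[of r s] eval_word_append[OF f, of u "r @ v"] eval_word_append[OF f, of u "s @ v"]
      eval_word_append[OF f, of r v] eval_word_append[OF f, of s v] by simp
qed simp_all

lemma (in group)
  assumes f: "f \<in> X \<rightarrow> carrier G"
    and R: "\<And>r s. (r, s) \<in> R \<Longrightarrow> r \<in> words X \<Longrightarrow> s \<in> words X \<Longrightarrow> eval_word G f r = eval_word G f s"
  shows pres_lift_class: "w \<in> words X \<Longrightarrow> pres_lift G f (pres_rel X R `` {w}) = eval_word G f w"
    and pres_lift_hom: "pres_lift G f \<in> hom (presented_group X R) G"
    and pres_lift_gen: "x \<in> X \<Longrightarrow> pres_lift G f (pres_gen X R x) = f x"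
proof -
  show *: "pres_lift G f (pres_rel X R `` {w}) = eval_word G f w" if "w \<in> words X" for w
  proof -
    have "w \<in> pres_rel X R `` {w}" using that by (auto intro: pres_rel.refl)
    then have "(SOME v. v \<in> pres_rel X R `` {w}) \<in> pres_rel X R `` {w}" by (rule someI)
    then have "(w, SOME v. v \<in> pres_rel X R `` {w}) \<in> pres_rel X R" by simp
    from eval_word_respects[OF f R this] show ?thesis by (simp add: pres_lift_def)
  qed
  show "pres_lift G f \<in> hom (presented_group X R) G"
  proof (rule homI)
    fix A assume "A \<in> carrier (presented_group X R)"
    then obtain v where v: "v \<in> words X" "A = pres_rel X R `` {v}"
      by (rule presented_group_carrierE)
    then show "pres_lift G f A \<in> carrier G"
      using eval_word_closed[OF f] by (simp add: *)
    fix B assume "B \<in> carrier (presented_group X R)"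
    then obtain w where w: "w \<in> words X" "B = pres_rel X R `` {w}"
      by (rule presented_group_carrierE)
    show "pres_lift G f (A \<otimes>\<^bsub>presented_group X R\<^esub> B) = pres_lift G f A \<otimes> pres_lift G f B"
      using v w eval_word_append[OF f] by (simp add: * presented_group_mult)
  qed
  show "pres_lift G f (pres_gen X R x) = f x" if "x \<in> X"
  proof -
    have "f x \<in> carrier G" using that f by blast
    then show ?thesis using that *[of "[Gen x]"] by (simp add: pres_gen_def)
  qed
qed


section \<open>The unrestricted virtual braid group\<close>

datatype uvb_gen = Sigma nat | Rho nat

abbreviation sg :: "nat \<Rightarrow> uvb_gen letter" where "sg i \<equiv> Gen (Sigma i)"
abbreviation rh :: "nat \<Rightarrow> uvb_gen letter" where "rh i \<equiv> Gen (Rho i)"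

definition uvb_gens :: "nat \<Rightarrow> uvb_gen set" where
  "uvb_gens n = Sigma ` {1..n - 1} \<union> Rho ` {1..n - 1}"

definition uvb_rels :: "nat \<Rightarrow> (uvb_gen word \<times> uvb_gen word) set" where
  "uvb_rels n =
     {([sg i, sg (i+1), sg i], [sg (i+1), sg i, sg (i+1)]) | i. i \<in> {1..n - 2}}
   \<union> {([sg i, sg j], [sg j, sg i]) | i j. i \<in> {1..n - 1} \<and> j \<in> {1..n - 1} \<and> \<bar>int i - int j\<bar> > 1}
   \<union> {([rh i, rh (i+1), rh i], [rh (i+1), rh i, rh (i+1)]) | i. i \<in> {1..n - 2}}
   \<union> {([rh i, rh j], [rh j, rh i]) | i j. i \<in> {1..n - 1} \<and> j \<in> {1..n - 1} \<and> \<bar>int i - int j\<bar> > 1}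
   \<union> {([rh i, rh i], []) | i. i \<in> {1..n - 1}}
   \<union> {([sg i, rh j], [rh j, sg i]) | i j. i \<in> {1..n - 1} \<and> j \<in> {1..n - 1} \<and> \<bar>int i - int j\<bar> > 1}
   \<union> {([sg i, rh (i+1), rh i], [rh (i+1), rh i, sg (i+1)]) | i. i \<in> {1..n - 2}}
   \<union> {([rh i, sg (i+1), sg i], [sg (i+1), sg i, rh (i+1)]) | i. i \<in> {1..n - 2}}
   \<union> {([rh (i+1), sg i, sg (i+1)], [sg i, sg (i+1), rh i]) | i. i \<in> {1..n - 2}}"

definition UVB :: "nat \<Rightarrow> uvb_gen word set monoid" where
  "UVB n = presented_group (uvb_gens n) (uvb_rels n)"

definition uvb_elem :: "nat \<Rightarrow> uvb_gen \<Rightarrow> uvb_gen word set" where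
  "uvb_elem n = pres_gen (uvb_gens n) (uvb_rels n)"

fun phi_gen :: "uvb_gen \<Rightarrow> nat \<Rightarrow> nat" where
  "phi_gen (Sigma i) = transpose i (i + 1)"
| "phi_gen (Rho i) = transpose i (i + 1)"

definition phi :: "nat \<Rightarrow> uvb_gen word set \<Rightarrow> nat \<Rightarrow> nat" where
  "phi n = pres_lift (sym_group n) phi_gen"

lemma group_UVB: "group (UVB n)"
  by (simp add: UVB_def group_presented_group)

lemma phi_gen_closed: "phi_gen \<in> uvb_gens n \<rightarrow> carrier (sym_group n)"
  by (auto simp: uvb_gens_def sym_group_def intro!: permutes_swap_id)

lemma phi_gen_respects:
  assumes "(r, s) \<in> uvb_rels n"
  shows "eval_word (sym_group n) phi_gen r = eval_word (sym_group n) phi_gen s"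
proof -
  have braid: "transpose i (Suc i) \<circ> (transpose (Suc i) (Suc (Suc i)) \<circ> transpose i (Suc i)) =
      transpose (Suc i) (Suc (Suc i)) \<circ> (transpose i (Suc i) \<circ> transpose (Suc i) (Suc (Suc i)))"
    for i :: nat
    by (simp add: fun_eq_iff transpose_def)
  have comm: "transpose i (Suc i) \<circ> transpose j (Suc j) = transpose j (Suc j) \<circ> transpose i (Suc i)"
    if "\<bar>int i - int j\<bar> > 1" for i j
  proof -
    have "i \<noteq> j" "i \<noteq> Suc j" "Suc i \<noteq> j" using that by auto
    then show ?thesis by (auto simp: fun_eq_iff transpose_def)
  qed
  show ?thesis
    using assms unfolding uvb_rels_def
    by (elim UnE) (auto simp: sym_group_mult sym_group_one braid comm)
qed

lemma phi_hom: "phi n \<in> hom (UVB n) (sym_group n)"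
  unfolding phi_def UVB_def
  by (rule group.pres_lift_hom[OF sym_group_is_group phi_gen_closed phi_gen_respects])

lemma phi_generators:
  assumes "i \<in> {1..n - 1}"
  shows "phi n (uvb_elem n (Sigma i)) = transpose i (i + 1)"
    and "phi n (uvb_elem n (Rho i)) = transpose i (i + 1)"
proof -
  have "Sigma i \<in> uvb_gens n" "Rho i \<in> uvb_gens n"
    using assms by (auto simp: uvb_gens_def)
  then show "phi n (uvb_elem n (Sigma i)) = transpose i (i + 1)"
    and "phi n (uvb_elem n (Rho i)) = transpose i (i + 1)"
    unfolding phi_def uvb_elem_def
    by (simp_all only: phi_gen.simps
          group.pres_lift_gen[OF sym_group_is_group phi_gen_closed phi_gen_respects])
qed


section \<open>Homomorphisms\<close>

definition conjugate_homs ::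
  "('a, 'c) monoid_scheme \<Rightarrow> ('b, 'd) monoid_scheme \<Rightarrow> ('a \<Rightarrow> 'b) \<Rightarrow> ('a \<Rightarrow> 'b) \<Rightarrow> bool" where
  "conjugate_homs G H h\<^sub>1 h\<^sub>2 \<longleftrightarrow> h\<^sub>1 \<in> hom G H \<and> h\<^sub>2 \<in> hom G H \<and>
     (\<exists>x\<in>carrier H. \<forall>g\<in>carrier G. h\<^sub>2 g = x \<otimes>\<^bsub>H\<^esub> h\<^sub>1 g \<otimes>\<^bsub>H\<^esub> inv\<^bsub>H\<^esub> x)"

definition abelian_hom ::
  "('a, 'c) monoid_scheme \<Rightarrow> ('b, 'd) monoid_scheme \<Rightarrow> ('a \<Rightarrow> 'b) \<Rightarrow> bool" where
  "abelian_hom G H h \<longleftrightarrow> h \<in> hom G H \<and> comm_group (H\<lparr>carrier := h ` carrier G\<rparr>)"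

definition inner_automorphism :: "('a, 'b) monoid_scheme \<Rightarrow> ('a \<Rightarrow> 'a) \<Rightarrow> bool" where
  "inner_automorphism G v \<longleftrightarrow>
     (\<exists>x\<in>carrier G. \<forall>g\<in>carrier G. v g = x \<otimes>\<^bsub>G\<^esub> g \<otimes>\<^bsub>G\<^esub> inv\<^bsub>G\<^esub> x)"

definition outer_automorphism :: "('a, 'b) monoid_scheme \<Rightarrow> ('a \<Rightarrow> 'a) \<Rightarrow> bool" where
  "outer_automorphism G v \<longleftrightarrow> v \<in> iso G G \<and> \<not> inner_automorphism G v"


section \<open>The outer automorphism of the symmetric group of degree 6\<close>

text \<open>To see that a non-inner automorphism of the symmetric group of degree 6 exists, let it act on
  the six partitions (totals) of the set of edges of the complete graph on \<open>{1..6}\<close> into five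
  perfect matchings.\<close>

definition totals :: "nat set set set list" where
  "totals = [
    {{{1, 2}, {3, 4}, {5, 6}},
     {{1, 3}, {2, 5}, {4, 6}},
     {{1, 4}, {2, 6}, {3, 5}},
     {{1, 5}, {2, 4}, {3, 6}},
     {{1, 6}, {2, 3}, {4, 5}}},
    {{{1, 2}, {3, 4}, {5, 6}},
     {{1, 3}, {2, 6}, {4, 5}},
     {{1, 4}, {2, 5}, {3, 6}},
     {{1, 5}, {2, 3}, {4, 6}},
     {{1, 6}, {2, 4}, {3, 5}}},
    {{{1, 2}, {3, 5}, {4, 6}},
     {{1, 3}, {2, 4}, {5, 6}},
     {{1, 4}, {2, 5}, {3, 6}},
     {{1, 5}, {2, 6}, {3, 4}},
     {{1, 6}, {2, 3}, {4, 5}}},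
    {{{1, 2}, {3, 5}, {4, 6}},
     {{1, 3}, {2, 6}, {4, 5}},
     {{1, 4}, {2, 3}, {5, 6}},
     {{1, 5}, {2, 4}, {3, 6}},
     {{1, 6}, {2, 5}, {3, 4}}},
    {{{1, 2}, {3, 6}, {4, 5}},
     {{1, 3}, {2, 4}, {5, 6}},
     {{1, 4}, {2, 6}, {3, 5}},
     {{1, 5}, {2, 3}, {4, 6}},
     {{1, 6}, {2, 5}, {3, 4}}},
    {{{1, 2}, {3, 6}, {4, 5}},
     {{1, 3}, {2, 5}, {4, 6}},
     {{1, 4}, {2, 3}, {5, 6}},
     {{1, 5}, {2, 6}, {3, 4}},
     {{1, 6}, {2, 4}, {3, 5}}}]"

definition relabel :: "(nat \<Rightarrow> nat) \<Rightarrow> nat set set set \<Rightarrow> nat set set set" where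
  "relabel p t = (\<lambda>s. (\<lambda>d. p ` d) ` s) ` t"

definition total :: "nat \<Rightarrow> nat set set set" where
  "total i = totals ! (i - 1)"

definition exotic :: "(nat \<Rightarrow> nat) \<Rightarrow> nat \<Rightarrow> nat" where
  "exotic p i = (if i \<in> {1..6} then inv_into {1..6} total (relabel p (total i)) else i)"

lemma relabel_transpose_totals:
  assumes "a \<in> {1..6}" "b \<in> {1..6}" "a < b" "t \<in> set totals"
  shows "relabel (transpose a b) t \<in> set totals"
proof -
  have "\<forall>(a, b)\<in>{(1,2), (1,3), (1,4), (1,5), (1,6), (2,3), (2,4), (2,5), (2,6), (3,4), (3,5),
      (3,6), (4,5), (4,6), (5,6)}. \<forall>t\<in>set totals. relabel (transpose a b) t \<in> set totals"
    by code_simp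
  moreover have "(a, b) \<in> {(1,2), (1,3), (1,4), (1,5), (1,6), (2,3), (2,4), (2,5), (2,6), (3,4), (3,5),
      (3,6), (4,5), (4,6), (5,6)}"
  proof -
    have "a \<in> {1, 2, 3, 4, 5, 6}" "b \<in> {1, 2, 3, 4, 5, 6}"
      using assms(1,2) by (simp_all, linarith+)
    then show ?thesis using assms(3) by (elim insertE emptyE) simp_all
  qed
  ultimately show ?thesis using assms(4) by blast
qed

lemma totals_separate:
  "\<forall>s\<in>\<Union>(set totals). \<exists>t\<in>set totals. \<exists>t'\<in>set totals. t \<inter> t' = {s}"
  "\<forall>d\<in>\<Union>(\<Union>(set totals)). \<exists>s\<in>\<Union>(set totals). \<exists>s'\<in>\<Union>(set totals). s \<inter> s' = {d}"
  "\<forall>x\<in>{1..6}. \<exists>d\<in>\<Union>(\<Union>(set totals)). \<exists>d'\<in>\<Union>(\<Union>(set totals)). d \<inter> d' = {x}"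
  by code_simp+

lemma relabel_transpose_12: "\<forall>t\<in>set totals. relabel (transpose 1 2) t \<noteq> t"
  by code_simp

lemma distinct_totals: "distinct totals"
  by code_simp

lemma exotic_outside: "i \<notin> {1..6} \<Longrightarrow> exotic p i = i"
  unfolding exotic_def by (rule if_not_P)

lemma bij_total: "bij_betw total {1..6} (set totals)"
proof -
  have "length totals = 6" by (simp add: totals_def)
  then have "bij_betw ((!) totals) {..<6} (set totals)"
    using distinct_totals by (intro bij_betw_nth) auto
  moreover have "bij_betw (\<lambda>i::nat. i - 1) {1..6} {..<6}"
    by (rule bij_betw_byWitness[where f' = Suc]) auto
  ultimately show ?thesis
    using bij_betw_trans[of "\<lambda>i. i - 1" "{1..6}" "{..<6}" "(!) totals" "set totals"]
    by (simp add: total_def[abs_def] comp_def)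
qed

lemma relabel_id [simp]: "relabel id t = t" "relabel (\<lambda>x. x) t = t"
  by (simp_all add: relabel_def id_def)

lemma relabel_comp: "relabel (p \<circ> q) t = relabel p (relabel q t)"
  by (simp add: relabel_def image_image)

lemma relabel_totals:
  assumes "p permutes {1..6}" shows "\<forall>t\<in>set totals. relabel p t \<in> set totals"
  using assms finite_atLeastAtMost
proof (induction p rule: permutes_induct)
  case id
  then show ?case by simp
next
  case (swap a b p)
  have "\<forall>t\<in>set totals. relabel (transpose a b) t \<in> set totals"
  proof (cases "a < b")
    case True
    then show ?thesis using relabel_transpose_totals swap.hyps by blast
  next
    case False
    then have "b < a" using swap.hyps by simp
    then show ?thesis
      using relabel_transpose_totals swap.hyps by (subst transpose_commute) blast
  qed
  then show ?case using swap.IH by (simp only: relabel_comp) blast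
qed

lemma total_exotic:
  assumes "p permutes {1..6}" "i \<in> {1..6}"
  shows "exotic p i \<in> {1..6}" "total (exotic p i) = relabel p (total i)"
proof -
  have "total ` {1..6} = set totals" using bij_total by (simp add: bij_betw_def)
  then have "relabel p (total i) \<in> total ` {1..6}"
    using relabel_totals[OF assms(1)] assms(2) by blast
  then show "exotic p i \<in> {1..6}" "total (exotic p i) = relabel p (total i)"
    unfolding exotic_def if_P[OF assms(2)] by (rule inv_into_into, rule f_inv_into_f)
qed

lemma total_eqD: "total i = total j \<Longrightarrow> i \<in> {1..6} \<Longrightarrow> j \<in> {1..6} \<Longrightarrow> i = j"
  using bij_total unfolding bij_betw_def by (blast dest: inj_onD)

lemma exotic_comp:
  assumes "p permutes {1..6}" "q permutes {1..6}"
  shows "exotic (p \<circ> q) = exotic p \<circ> exotic q"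
proof
  fix i
  show "exotic (p \<circ> q) i = (exotic p \<circ> exotic q) i"
  proof (cases "i \<in> {1..6}")
    case True
    note pq = permutes_compose[OF assms(2,1)]
    note q = total_exotic[OF assms(2) True]
    have "total (exotic (p \<circ> q) i) = total (exotic p (exotic q i))"
      using total_exotic(2)[OF pq True] total_exotic(2)[OF assms(1) q(1)] q(2)
      by (simp add: relabel_comp)
    then show ?thesis
      using total_eqD total_exotic(1)[OF pq True] total_exotic(1)[OF assms(1) q(1)] by simp
  next
    case False
    then show ?thesis by (simp add: exotic_outside del: One_nat_def)
  qed
qed

lemma exotic_id: "exotic id = id"
proof
  fix i
  show "exotic id i = id i"
  proof (cases "i \<in> {1..6}")
    case True
    then have "total (exotic id i) = total i"
      using total_exotic(2)[OF permutes_id True] by simp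
    then show ?thesis using total_eqD total_exotic(1)[OF permutes_id True] True by simp
  next
    case False
    then show ?thesis by (simp add: exotic_outside del: One_nat_def)
  qed
qed

lemma exotic_permutes:
  assumes "p permutes {1..6}" shows "exotic p permutes {1..6}"
proof (rule bij_imp_permutes)
  note p' = permutes_inv[OF assms]
  have "exotic p (exotic (Hilbert_Choice.inv p) i) = i" "exotic (Hilbert_Choice.inv p) (exotic p i) = i" for i
    using exotic_comp[OF assms p'] exotic_comp[OF p' assms]
    by (simp_all add: permutes_inv_o[OF assms] exotic_id fun_eq_iff)
  then show "bij_betw (exotic p) {1..6} {1..6}"
    using total_exotic(1)[OF assms] total_exotic(1)[OF p']
    by (intro bij_betw_byWitness[where f' = "exotic (Hilbert_Choice.inv p)"]) blast+
qed (rule exotic_outside)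

lemma exotic_kernel:
  assumes p: "p permutes {1..6}" and "exotic p = id"
  shows "p = id"
proof
  fix x
  have inj: "inj p" using p by (rule permutes_inj)
  define P where "P = image p"
  define Q where "Q = image P"
  have injP: "inj P" unfolding P_def by (rule injI) (simp add: inj_image_eq_iff[OF inj])
  have injQ: "inj Q" unfolding Q_def by (rule injI) (simp add: inj_image_eq_iff[OF injP])
  have relabel: "relabel p t = Q ` t" for t
    by (simp add: relabel_def P_def Q_def)
  have t: "Q ` t = t" if "t \<in> set totals" for t
  proof -
    have "t \<in> total ` {1..6}"
      using that by (simp only: bij_betw_imp_surj_on[OF bij_total])
    then obtain i where i: "t = total i" "i \<in> {1..6}" by (rule imageE)
    then show ?thesis
      using total_exotic(2)[OF p i(2)] assms(2) by (simp only: relabel id_apply)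
  qed
  have s: "Q s = s" if mem: "s \<in> \<Union>(set totals)" for s
  proof -
    obtain t\<^sub>1 t\<^sub>2 where "t\<^sub>1 \<in> set totals" "t\<^sub>2 \<in> set totals" "t\<^sub>1 \<inter> t\<^sub>2 = {s}"
      using bspec[OF totals_separate(1) mem] by (elim bexE)
    then have "Q ` {s} = {s}" using image_Int[OF injQ, of t\<^sub>1 t\<^sub>2] by (simp only: t)
    then show ?thesis by simp
  qed
  have d: "P d = d" if mem: "d \<in> \<Union>(\<Union>(set totals))" for d
  proof -
    obtain s\<^sub>1 s\<^sub>2 where "s\<^sub>1 \<in> \<Union>(set totals)" "s\<^sub>2 \<in> \<Union>(set totals)" "s\<^sub>1 \<inter> s\<^sub>2 = {d}"
      using bspec[OF totals_separate(2) mem] by (elim bexE)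
    then have "P ` {d} = {d}" using image_Int[OF injP, of s\<^sub>1 s\<^sub>2] by (simp only: s[unfolded Q_def])
    then show ?thesis by simp
  qed
  show "p x = id x"
  proof (cases "x \<in> {1..6}")
    case True
    obtain d\<^sub>1 d\<^sub>2 where "d\<^sub>1 \<in> \<Union>(\<Union>(set totals))" "d\<^sub>2 \<in> \<Union>(\<Union>(set totals))" "d\<^sub>1 \<inter> d\<^sub>2 = {x}"
      using bspec[OF totals_separate(3) True] by (elim bexE)
    then have "p ` {x} = {x}" using image_Int[OF inj, of d\<^sub>1 d\<^sub>2] by (simp only: d[unfolded P_def])
    then show ?thesis by simp
  next
    case False
    then show ?thesis using permutes_not_in[OF p] by simp
  qed
qed

lemma exotic_outer: "outer_automorphism (sym_group 6) exotic"
  unfolding outer_automorphism_def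
proof
  have hom: "exotic \<in> hom (sym_group 6) (sym_group 6)"
    by (rule homI) (simp_all add: sym_group_def exotic_permutes exotic_comp del: One_nat_def)
  interpret group_hom "sym_group 6" "sym_group 6" exotic
    using hom by (intro group_hom.intro group_hom_axioms.intro sym_group_is_group)
  have inj: "inj_on exotic (carrier (sym_group 6))"
    unfolding inj_on_one_iff using exotic_kernel
    by (simp add: sym_group_carrier sym_group_one del: One_nat_def)
  have "finite (carrier (sym_group 6))"
    by (simp add: sym_group_def finite_permutations)
  moreover have "exotic ` carrier (sym_group 6) \<subseteq> carrier (sym_group 6)"
    by (simp add: image_subset_iff)
  ultimately have "exotic ` carrier (sym_group 6) = carrier (sym_group 6)"
    using inj by (intro endo_inj_surj)
  with hom inj show "exotic \<in> iso (sym_group 6) (sym_group 6)" by (simp only: Group.iso_iff)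
next
  show "\<not> inner_automorphism (sym_group 6) exotic"
  proof
    assume "inner_automorphism (sym_group 6) exotic"
    moreover have tr: "transpose 1 2 permutes {1..6::nat}" by (rule permutes_swap_id) simp_all
    ultimately obtain x where x: "x permutes {1..6}"
      and "exotic (transpose 1 2) = x \<circ> transpose 1 2 \<circ> Hilbert_Choice.inv x"
      by (auto simp: inner_automorphism_def sym_group_carrier sym_group_mult
          simp del: One_nat_def)
    then have "exotic (transpose 1 2) (x 3) = x 3"
      using permutes_inverses(2)[OF x] by (simp add: transpose_def)
    moreover have x3: "x 3 \<in> {1..6}" using permutes_in_image[OF x, of 3] by simp
    ultimately have "relabel (transpose 1 2) (total (x 3)) = total (x 3)"
      using total_exotic(2)[OF tr x3] by simp
    moreover have "total (x 3) \<in> set totals" 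
      using imageI[OF x3, of total] by (simp only: bij_betw_imp_surj_on[OF bij_total])
    ultimately show False using relabel_transpose_12 by blast
  qed
qed

text \<open>Non-inner automorphisms of this group differ only by inner ones, so up to conjugation
  nothing depends on the choice.\<close>

definition v6 :: "(nat \<Rightarrow> nat) \<Rightarrow> nat \<Rightarrow> nat" where
  "v6 = (SOME v. outer_automorphism (sym_group 6) v)"

lemma outer_v6: "outer_automorphism (sym_group 6) v6"
  unfolding v6_def by (rule someI[of "outer_automorphism (sym_group 6)", OF exotic_outer])

end

theory Submission
  imports Defs
begin

text \<open>Write \<open>s i\<close> and \<open>t i\<close> for the images of \<open>\<sigma>\<^sub>i\<close> and \<open>\<rho>\<^sub>i\<close> under \<open>h\<close>. The \<open>t i\<close> satisfy the
  Coxeter relations of \<open>S\<^sub>n\<close>, and everything is governed by whether they coincide.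

  If \<open>t 1 = t 2\<close>, the commutation and braid relations propagate the equality along the Coxeter
  diagram, so all \<open>t i\<close> are one involution \<open>t\<close>. The relation
  \<open>\<sigma>\<^sub>i \<rho>\<^sub>i\<^sub>+\<^sub>1 \<rho>\<^sub>i = \<rho>\<^sub>i\<^sub>+\<^sub>1 \<rho>\<^sub>i \<sigma>\<^sub>i\<^sub>+\<^sub>1\<close> then makes all \<open>s i\<close> equal, and \<open>\<sigma>\<^sub>1 \<rho>\<^sub>3 = \<rho>\<^sub>3 \<sigma>\<^sub>1\<close> makes them
  commute with \<open>t\<close>; so \<open>h\<close> is Abelian (\<open>abelian_if_t_agree\<close>).

  If \<open>t 1 \<noteq> t 2\<close>, the claim is that \<open>t 1\<close> is a transposition, or \<open>n = 6\<close> and \<open>t 1\<close> has no fixed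
  point (\<open>coxeter_action_small_degree\<close>). The idea is that \<open>t 3, \<dots>, t (n - 1)\<close> centralise \<open>t 1\<close>, so that they
  permute the fixed points and the 2-cycles of \<open>t 1\<close>. If \<open>t 1\<close> has at least two 2-cycles and the
  exceptional case is excluded, both sets are too small for \<open>S\<^sub>n\<^sub>-\<^sub>2\<close> to act on them through distinct
  generators, by induction from \<open>n - 2\<close> to \<open>n\<close>. Hence \<open>t 3\<close> and \<open>t 4\<close> agree on both sets, so \<open>t 3 \<circ> t 4\<close> fixes the
  fixed points of \<open>t 1\<close>, preserves every 2-cycle and has order dividing both 2 and 3 there;
  so \<open>t 3 = t 4\<close> and all generators coincide.

  If \<open>t 1\<close> is a transposition, so are all \<open>t i\<close>, and their supports form a chain
  \<open>{a\<^sub>1, a\<^sub>2}, {a\<^sub>2, a\<^sub>3}, \<dots>\<close> (\<open>transposition_chain\<close>). Renaming the points turns \<open>t i\<close> into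
  \<open>(i, i + 1)\<close>. Then \<open>s 1\<close> centralises all permutations of \<open>{3..n}\<close>, which forces it to be trivial
  or \<open>(1, 2)\<close>; the relation
  \<open>\<rho>\<^sub>1 \<sigma>\<^sub>2 \<sigma>\<^sub>1 = \<sigma>\<^sub>2 \<sigma>\<^sub>1 \<rho>\<^sub>2\<close> excludes the former, and \<open>h\<close> has become \<open>\<phi>\<close>
  (\<open>is_phi_if_t_standard\<close>).

  In the exceptional case, the same dichotomy applies to \<open>v\<^sub>6\<^sup>-\<^sup>1 \<circ> h\<close>. If it sends \<open>\<rho>\<^sub>1\<close> to a
  transposition, it is conjugate to \<open>\<phi>\<close>, so \<open>h\<close> is conjugate to \<open>v\<^sub>6 \<circ> \<phi>\<close>. It cannot send \<open>\<rho>\<^sub>1\<close> to a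
  fixed-point-free involution: \<open>v\<^sub>6\<close> maps transpositions to fixed-point-free involutions, since it would be inner
  otherwise, and the fixed-point-free involutions form one conjugacy class, so if one of them were mapped into the class
  then \<open>v\<^sub>6\<close> would map a strictly larger finite set injectively into it
  (\<open>outer_automorphism_6_fpf_not_fpf\<close>).\<close>

section \<open>Actions of the Coxeter generators of a symmetric group\<close>

text \<open>The relations are required only at the points of \<open>\<Omega>\<close>, so that restricting to an invariant subset
  needs no change of type or of generators. \<open>N\<close> is the degree of the acting symmetric group: \<open>r i\<close>
  plays the transposition of \<open>i\<close> and \<open>i + 1\<close> in \<open>{0..<N}\<close>, and exists for \<open>Suc i < N\<close>.\<close>

locale coxeter_action =
  fixes N :: nat and r :: "nat \<Rightarrow> 'a \<Rightarrow> 'a" and \<Omega> :: "'a set"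
  assumes closed: "Suc i < N \<Longrightarrow> x \<in> \<Omega> \<Longrightarrow> r i x \<in> \<Omega>"
    and invol: "Suc i < N \<Longrightarrow> x \<in> \<Omega> \<Longrightarrow> r i (r i x) = x"
    and braid: "Suc (Suc i) < N \<Longrightarrow> x \<in> \<Omega> \<Longrightarrow>
      r i (r (Suc i) (r i x)) = r (Suc i) (r i (r (Suc i) x))"
    and far: "Suc i < j \<Longrightarrow> Suc j < N \<Longrightarrow> x \<in> \<Omega> \<Longrightarrow> r i (r j x) = r j (r i x)"
begin

definition degenerate :: bool where
  "degenerate \<longleftrightarrow> (\<forall>i. Suc i < N \<longrightarrow> (\<forall>x\<in>\<Omega>. r i x = r 0 x))"

definition moved :: "nat \<Rightarrow> 'a set" where
  "moved i = {x \<in> \<Omega>. r i x \<noteq> x}"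

text \<open>For commuting involutions \<open>a\<close> and \<open>b\<close> the braid relation \<open>a b a = b a b\<close> collapses to \<open>b = a\<close>.\<close>

lemma commuting_neighbours_agree:
  assumes "Suc (Suc i) < N" "\<And>x. x \<in> \<Omega> \<Longrightarrow> r i (r (Suc i) x) = r (Suc i) (r i x)" "x \<in> \<Omega>"
  shows "r i x = r (Suc i) x"
proof -
  have N: "Suc i < N" using assms(1) by simp
  have "r i (r (Suc i) (r i x)) = r (Suc i) x"
    using assms N by (simp add: closed invol)
  moreover have "r (Suc i) (r i (r (Suc i) x)) = r i x"
    using assms N by (simp add: closed invol)
  ultimately show ?thesis using braid assms(1,3) by simp
qed

text \<open>The next three lemmas are one observation in different positions: if two generators agree, a third
  generator that commutes with one of them commutes with the other as well, and coincides with it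
  when they are neighbours.\<close>

lemma agree_up:
  assumes N: "Suc (Suc j) < N" and ij: "i < j" and agree: "\<forall>x\<in>\<Omega>. r i x = r j x"
  shows "\<forall>x\<in>\<Omega>. r j x = r (Suc j) x"
proof
  fix x assume x: "x \<in> \<Omega>"
  show "r j x = r (Suc j) x"
  proof (rule commuting_neighbours_agree[OF N _ x])
    fix y assume y: "y \<in> \<Omega>"
    have "r j (r (Suc j) y) = r i (r (Suc j) y)" using agree closed[OF N y] by simp
    also have "\<dots> = r (Suc j) (r i y)" using far[of i "Suc j" y] ij N y by simp
    also have "r i y = r j y" using agree y by simp
    finally show "r j (r (Suc j) y) = r (Suc j) (r j y)" .
  qed
qed

lemma agree_down:
  assumes N: "Suc j < N" and ij: "Suc i < j" and agree: "\<forall>x\<in>\<Omega>. r (Suc i) x = r j x"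
  shows "\<forall>x\<in>\<Omega>. r i x = r (Suc i) x"
proof
  fix x assume x: "x \<in> \<Omega>"
  have N': "Suc (Suc i) < N" "Suc i < N" using N ij by simp_all
  show "r i x = r (Suc i) x"
  proof (rule commuting_neighbours_agree[OF N'(1) _ x])
    fix y assume y: "y \<in> \<Omega>"
    have "r i (r (Suc i) y) = r i (r j y)" using agree y by simp
    also have "\<dots> = r j (r i y)" by (rule far[OF ij N y])
    also have "\<dots> = r (Suc i) (r i y)" using agree closed[OF N'(2) y] by simp
    finally show "r i (r (Suc i) y) = r (Suc i) (r i y)" .
  qed
qed

lemma agree_between:
  assumes N: "Suc j < N" and ij: "Suc (Suc i) < j" and agree: "\<forall>x\<in>\<Omega>. r i x = r j x"
  shows "\<forall>x\<in>\<Omega>. r i x = r (Suc i) x"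
proof
  fix x assume x: "x \<in> \<Omega>"
  have N': "Suc (Suc i) < N" using N ij by simp
  show "r i x = r (Suc i) x"
  proof (rule commuting_neighbours_agree[OF N' _ x])
    fix y assume y: "y \<in> \<Omega>"
    have "r i (r (Suc i) y) = r j (r (Suc i) y)" using agree closed[OF N' y] by simp
    also have "\<dots> = r (Suc i) (r j y)" by (rule far[OF ij N y, symmetric])
    also have "r j y = r i y" using agree y by simp
    finally show "r i (r (Suc i) y) = r (Suc i) (r i y)" .
  qed
qed

lemma agree_spreads:
  assumes "Suc (Suc i) < N" "Suc (Suc j) < N" "\<forall>x\<in>\<Omega>. r i x = r (Suc i) x"
  shows "\<forall>x\<in>\<Omega>. r j x = r (Suc j) x"
proof (cases "i \<le> j")
  case True
  then show ?thesis using assms(2)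
  proof (induction j rule: dec_induct)
    case base
    show ?case by (rule assms(3))
  next
    case (step k)
    show ?case by (rule agree_up[of _ k]) (use step in simp_all)
  qed
next
  case False
  then have "j \<le> i" by simp
  then show ?thesis using assms(1,2)
  proof (induction j rule: inc_induct)
    case base
    show ?case by (rule assms(3))
  next
    case (step k)
    show ?case by (rule agree_down[of "Suc (Suc k)"]) (use step in simp_all)
  qed
qed

lemma degenerateI:
  assumes "Suc (Suc i) < N" "\<forall>x\<in>\<Omega>. r i x = r (Suc i) x"
  shows degenerate
  unfolding degenerate_def
proof (intro allI impI)
  fix j assume "Suc j < N"
  then show "\<forall>x\<in>\<Omega>. r j x = r 0 x"
  proof (induction j)
    case (Suc j)
    then have "\<forall>x\<in>\<Omega>. r j x = r 0 x" by simp
    moreover have "\<forall>x\<in>\<Omega>. r j x = r (Suc j) x"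
      using agree_spreads[OF assms(1) Suc.prems assms(2)] .
    ultimately show ?case by metis
  qed simp
qed

text \<open>Degree 4 has to be excluded, where the Klein four-group is normal: there the action on three
  points identifies the first and the third generator only. For \<open>N \<ge> 5\<close> there is always a further
  generator adjacent to exactly one of \<open>i\<close> and \<open>j\<close>.\<close>

lemma degenerateI_far:
  assumes "5 \<le> N" "Suc i < j" "Suc j < N" "\<forall>x\<in>\<Omega>. r i x = r j x"
  shows degenerate
proof -
  have "Suc (Suc j) < N \<or> i \<noteq> 0 \<or> Suc (Suc i) < j" using assms(1-3) by linarith
  then consider "Suc (Suc j) < N" | k where "i = Suc k" | "Suc (Suc i) < j"
    using not0_implies_Suc by blast
  then show ?thesis
  proof cases
    case 1
    show ?thesis by (rule degenerateI[OF 1 agree_up[OF 1 _ assms(4)]]) (use assms(2) in simp)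
  next
    case 2
    have "\<forall>x\<in>\<Omega>. r k x = r (Suc k) x"
      by (rule agree_down[OF assms(3)]) (use 2 assms in simp_all)
    then show ?thesis by (rule degenerateI[rotated]) (use 2 assms in simp)
  next
    case 3
    show ?thesis by (rule degenerateI[OF _ agree_between[OF assms(3) 3 assms(4)]]) (use 3 assms in simp)
  qed
qed

lemma moved_empty_imp_degenerate:
  assumes "moved 0 = {}" "3 \<le> N"
  shows degenerate
proof -
  have N: "Suc (Suc 0) < N" using assms(2) by simp
  have triv: "r 0 x = x" if "x \<in> \<Omega>" for x using assms(1) that by (auto simp: moved_def)
  have "r 0 x = r (Suc 0) x" if x: "x \<in> \<Omega>" for x
    by (rule commuting_neighbours_agree[OF N _ x]) (simp add: triv closed[OF N])
  then show ?thesis using degenerateI[OF N] by blast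
qed

lemma moved_neq: "x \<in> moved i \<Longrightarrow> r i x \<noteq> x"
  by (simp add: moved_def)

lemma moved_closed: "Suc i < N \<Longrightarrow> x \<in> moved i \<Longrightarrow> r i x \<in> moved i"
  using closed[of i x] invol[of i x] by (auto simp: moved_def)

text \<open>Neighbouring generators are conjugate: \<open>r i \<circ> r (i + 1)\<close> conjugates \<open>r i\<close> to \<open>r (i + 1)\<close> by the
  braid relation, so it carries the support of one to that of the other.\<close>

lemma card_moved:
  assumes "Suc i < N"
  shows "card (moved i) = card (moved 0)"
  using assms
proof (induction i)
  case (Suc i)
  let ?c = "\<lambda>x. r i (r (Suc i) x)" and ?d = "\<lambda>x. r (Suc i) (r i x)"
  have N: "Suc i < N" "Suc (Suc i) < N" using Suc.prems by auto
  note rules = closed[OF N(1)] closed[OF N(2)] invol[OF N(1)] invol[OF N(2)]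
  have eq: "r (Suc i) (?c x) = ?c (r i x)" if "x \<in> \<Omega>" for x
    by (rule braid[OF N(2) that, symmetric])
  have eq': "r i (?d x) = ?d (r (Suc i) x)" if "x \<in> \<Omega>" for x
    by (rule braid[OF N(2) that])
  have "bij_betw ?c (moved i) (moved (Suc i))"
  proof (rule bij_betw_byWitness[where f' = ?d])
    show "?c ` moved i \<subseteq> moved (Suc i)"
    proof (intro image_subsetI)
      fix x assume x: "x \<in> moved i"
      then have "x \<in> \<Omega>" "r i x \<noteq> x" by (auto simp: moved_def)
      then have "?c (r i x) \<noteq> ?c x" using rules(1)[of x] rules(3)[of "r i x"] rules(3,4) rules(1,2) by metis
      then show "?c x \<in> moved (Suc i)" using eq \<open>x \<in> \<Omega>\<close> rules by (simp add: moved_def)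
    qed
    show "?d ` moved (Suc i) \<subseteq> moved i"
    proof (intro image_subsetI)
      fix x assume x: "x \<in> moved (Suc i)"
      then have "x \<in> \<Omega>" "r (Suc i) x \<noteq> x" by (auto simp: moved_def)
      then have "?d (r (Suc i) x) \<noteq> ?d x" using rules by metis
      then show "?d x \<in> moved i" using eq' \<open>x \<in> \<Omega>\<close> rules by (simp add: moved_def)
    qed
  qed (simp_all add: moved_def rules)
  then have "card (moved i) = card (moved (Suc i))" by (rule bij_betw_same_card)
  then show ?case using Suc.IH[OF N(1)] by simp
qed simp

lemma moved_pair:
  assumes "card (moved 0) = 2" "Suc i < N" "x \<in> moved i"
  shows "moved i = {x, r i x}"
proof -
  have "card (moved i) = 2" using card_moved assms by simp
  moreover have "{x, r i x} \<subseteq> moved i" using moved_closed assms by auto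
  moreover have "card {x, r i x} = 2" using assms(3) by (auto simp: moved_def)
  ultimately show ?thesis by (metis card.infinite card_subset_eq zero_neq_numeral)
qed

lemma moved_eq_imp_agree:
  assumes "card (moved 0) = 2" "Suc i < N" "Suc j < N" "moved i = moved j"
  shows "\<forall>x\<in>\<Omega>. r i x = r j x"
proof
  fix x assume x: "x \<in> \<Omega>"
  show "r i x = r j x"
  proof (cases "x \<in> moved i")
    case True
    then have xj: "x \<in> moved j" using assms(4) by simp
    have "{x, r i x} = {x, r j x}"
      using moved_pair[OF assms(1,2) True] moved_pair[OF assms(1,3) xj] assms(4) by simp
    then show ?thesis by (auto simp: doubleton_eq_iff)
  next
    case False
    then have "x \<notin> moved i" "x \<notin> moved j" using assms(4) by simp_all
    then show ?thesis using x unfolding moved_def by simp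
  qed
qed

text \<open>Commuting transpositions have equal or disjoint supports, and equal supports mean equal
  transpositions.\<close>

lemma moved_far_disjoint:
  assumes "card (moved 0) = 2" "5 \<le> N" "\<not> degenerate" "Suc i < j" "Suc j < N"
  shows "moved i \<inter> moved j = {}"
proof (rule ccontr)
  assume "moved i \<inter> moved j \<noteq> {}"
  then obtain x where x: "x \<in> moved i" "x \<in> moved j" by blast
  have N: "Suc i < N" using assms by simp
  have x\<Omega>: "x \<in> \<Omega>" "r i x \<noteq> x" using x by (auto simp: moved_def)
  have "r i (r j x) \<noteq> r j x"
    using far[OF assms(4,5) x\<Omega>(1)] x\<Omega> invol[OF assms(5)] closed[OF N] by metis
  then have "r j x \<in> moved i" using closed[OF assms(5)] x\<Omega> by (simp add: moved_def)
  then have "r j x = r i x" using moved_pair[OF assms(1) N x(1)] moved_neq[OF x(2)] by blast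
  then have "moved i = moved j"
    using moved_pair[OF assms(1) N x(1)] moved_pair[OF assms(1,5) x(2)] by simp
  then show False
    using moved_eq_imp_agree[OF assms(1) N assms(5)] degenerateI_far assms by blast
qed

text \<open>Transpositions with disjoint supports commute, so neighbouring generators with disjoint supports
  agree; with equal supports they agree as well. Two 2-element supports that are neither share
  exactly one point.\<close>

lemma moved_neighbours_meet:
  assumes "card (moved 0) = 2" "\<not> degenerate" "Suc (Suc i) < N"
  shows "\<exists>x. moved i \<inter> moved (Suc i) = {x}"
proof -
  have N: "Suc i < N" using assms by simp
  have ne: "moved i \<noteq> moved (Suc i)"
    using moved_eq_imp_agree[OF assms(1) N assms(3)] degenerateI[OF assms(3)] assms(2) by blast
  have "moved i \<inter> moved (Suc i) \<noteq> {}"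
  proof
    assume dis: "moved i \<inter> moved (Suc i) = {}"
    have "r i (r (Suc i) x) = r (Suc i) (r i x)" if x: "x \<in> \<Omega>" for x
    proof -
      consider "x \<in> moved i" | "x \<in> moved (Suc i)" | "r i x = x" "r (Suc i) x = x"
        using x by (auto simp: moved_def)
      then show ?thesis
      proof cases
        case 1
        then have "r i x \<notin> moved (Suc i)" "x \<notin> moved (Suc i)"
          using moved_closed[OF N 1] dis by auto
        then show ?thesis using closed[OF N x] x by (simp add: moved_def)
      next
        case 2
        then have "r (Suc i) x \<notin> moved i" "x \<notin> moved i"
          using moved_closed[OF assms(3) 2] dis by auto
        then show ?thesis using closed[OF assms(3) x] x by (simp add: moved_def)
      qed simp
    qed
    then have "\<forall>x\<in>\<Omega>. r i x = r (Suc i) x"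
      using commuting_neighbours_agree[OF assms(3)] by blast
    then show False using degenerateI[OF assms(3)] assms(2) by blast
  qed
  then obtain x where x: "x \<in> moved i" "x \<in> moved (Suc i)" by blast
  have "moved i = {x, r i x}" "moved (Suc i) = {x, r (Suc i) x}"
    using moved_pair[OF assms(1)] N assms(3) x by blast+
  then show ?thesis using ne by auto
qed

text \<open>The inner points of the chain are the common points of consecutive supports, and the two ends are
  the remaining points of the first and of the last support. They are distinct since generators that
  are not neighbours have disjoint supports.\<close>

lemma transposition_chain:
  assumes two: "card (moved 0) = 2" and N: "5 \<le> N" and nd: "\<not> degenerate"
  obtains a where "inj_on a {..<N}" "a ` {..<N} \<subseteq> \<Omega>"
    "\<And>i x. Suc i < N \<Longrightarrow> x \<in> \<Omega> \<Longrightarrow> r i x = transpose (a i) (a (Suc i)) x"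
proof -
  obtain m where m: "\<And>i. Suc (Suc i) < N \<Longrightarrow> moved i \<inter> moved (Suc i) = {m i}"
    using moved_neighbours_meet[OF two nd] by metis
  note disj = moved_far_disjoint[OF two N nd]
  \<comment> \<open>\<open>m i\<close> is the point shared by the supports of \<open>r i\<close> and \<open>r (i + 1)\<close>.\<close>
  define a where "a i = (if i = 0 then r 0 (m 0) else if Suc i < N then m (i - 1)
    else r (N - 2) (m (N - 3)))" for i
  have mid: "moved i \<inter> moved (Suc i) = {a (Suc i)}" if "Suc (Suc i) < N" for i
    using m[OF that] that by (simp add: a_def)
  have moved: "moved i = {a i, a (Suc i)}" "a i \<noteq> a (Suc i)" if i: "Suc i < N" for i
  proof -
    have "i = 0 \<or> Suc (Suc i) = N \<or> (i \<noteq> 0 \<and> Suc (Suc i) < N)" using i by linarith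
    then consider "i = 0" | "Suc (Suc i) = N" | j where "i = Suc j" "Suc (Suc i) < N"
      using not0_implies_Suc by blast
    then have "moved i = {a i, a (Suc i)} \<and> a i \<noteq> a (Suc i)"
    proof cases
      case 1
      have "m 0 \<in> moved 0" using m[of 0] N by auto
      then have "moved i = {m 0, r i (m 0)}" "r i (m 0) \<noteq> m 0"
        using moved_pair[OF two i] moved_neq 1 by blast+
      moreover have "a i = r i (m 0)" "a (Suc i) = m 0" using 1 N by (simp_all add: a_def)
      ultimately show ?thesis by (simp add: insert_commute)
    next
      case 2
      then obtain j where j: "i = Suc j" using N by (cases i) simp_all
      have "m j \<in> moved i" using m[of j] 2 j by auto
      then have "moved i = {m j, r i (m j)}" "r i (m j) \<noteq> m j"
        using moved_pair[OF two i] moved_neq by blast+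
      moreover have "N = Suc (Suc (Suc j))" using 2 j by simp
      then have "a i = m j" "a (Suc i) = r i (m j)" using j by (simp_all add: a_def)
      ultimately show ?thesis by simp
    next
      case 3
      have 1: "a i \<in> moved j" "a i \<in> moved i" using mid[of j] 3 by auto
      have 2: "a (Suc i) \<in> moved i" "a (Suc i) \<in> moved (Suc i)" using mid[of i] 3 by auto
      have "moved j \<inter> moved (Suc i) = {}" using 3 by (intro disj) simp_all
      then have ne: "a i \<noteq> a (Suc i)" using 1 2 by auto
      moreover have "moved i = {a i, r i (a i)}" by (rule moved_pair[OF two i 1(2)])
      ultimately show ?thesis using 2(1) by auto
    qed
    then show "moved i = {a i, a (Suc i)}" "a i \<noteq> a (Suc i)" by auto
  qed
  have left: "a i \<in> moved i" and right: "a (Suc i) \<in> moved i" if "Suc i < N" for i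
    using moved(1)[OF that] by simp_all
  have ne: "a i \<noteq> a j" if "i < j" "j < N" for i j
  proof (cases "j = Suc i")
    case True
    then show ?thesis using moved(2) that by simp
  next
    case False
    then have "j = Suc (j - 1)" "i < j - 1" using that by linarith+
    then obtain k where k: "j = Suc k" "i < k" by blast
    have i: "Suc i < N" and kN: "Suc k < N" using that k by simp_all
    show ?thesis
    proof (cases "Suc i < k")
      case True
      then show ?thesis using disj[OF True kN] left[OF i] right[OF kN] k(1) by auto
    next
      case False
      then have k': "k = Suc i" using k by simp
      show ?thesis
      proof (cases i)
        case 0
        have "Suc j < N" "Suc i < j" using 0 k k' N by simp_all
        then show ?thesis using disj[of i j] left[OF i] left[of j] by auto
      next
        case (Suc l)
        then have "Suc l < k" "Suc l < N" using k' i by simp_all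
        then show ?thesis using disj[of l k] right[of l] right[of k] kN k(1) Suc by auto
      qed
    qed
  qed
  show ?thesis
  proof
    show "inj_on a {..<N}"
      using ne by (intro linorder_inj_onI) auto
    show "a ` {..<N} \<subseteq> \<Omega>"
    proof (intro image_subsetI)
      fix i assume i: "i \<in> {..<N}"
      show "a i \<in> \<Omega>"
      proof (cases i)
        case 0
        then show ?thesis using left[of 0] N by (simp add: moved_def)
      next
        case (Suc j)
        then show ?thesis using right[of j] i by (simp add: moved_def)
      qed
    qed
    show "r i x = transpose (a i) (a (Suc i)) x" if i: "Suc i < N" and x: "x \<in> \<Omega>" for i x
    proof (cases "x \<in> moved i")
      case True
      have "{x, r i x} = {a i, a (Suc i)}" using moved_pair[OF two i True] moved(1)[OF i] by simp
      moreover have "r i x \<noteq> x" using True by (simp add: moved_def)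
      ultimately show ?thesis by (auto simp: doubleton_eq_iff)
    next
      case False
      then have "r i x = x" "x \<noteq> a i" "x \<noteq> a (Suc i)" using x moved(1)[OF i] by (auto simp: moved_def)
      then show ?thesis by (simp add: transpose_def)
    qed
  qed
qed

lemma card_ge_if_transpositions:
  assumes "card (moved 0) = 2" "5 \<le> N" "\<not> degenerate" "finite \<Omega>"
  shows "N \<le> card \<Omega>"
proof (rule transposition_chain[OF assms(1-3)])
  fix a assume "inj_on a {..<N}" "a ` {..<N} \<subseteq> \<Omega>"
  then show ?thesis using card_inj_on_le[of a "{..<N}" \<Omega>] assms(4) by simp
qed

text \<open>Any two permutations of at most two points commute.\<close>

lemma two_points_agree:
  assumes "3 \<le> N" "finite \<Omega>" "card \<Omega> \<le> 2" "x \<in> \<Omega>"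
  shows "r 0 x = r 1 x"
proof -
  have two: "v = x \<or> v = y" if "y \<in> \<Omega>" "v \<in> \<Omega>" "y \<noteq> x" for v y
  proof (rule ccontr)
    assume "\<not> (v = x \<or> v = y)"
    then have "card {v, x, y} = 3" using that by simp
    then show False using card_mono[OF assms(2), of "{v, x, y}"] assms that by simp
  qed
  have "r 0 z = r (Suc 0) z" if "z \<in> \<Omega>" for z
  proof (rule commuting_neighbours_agree[OF _ _ that])
    fix y assume y: "y \<in> \<Omega>"
    have r: "\<And>v. v \<in> \<Omega> \<Longrightarrow> r 0 v \<in> \<Omega>" "\<And>v. v \<in> \<Omega> \<Longrightarrow> r (Suc 0) v \<in> \<Omega>"
      "\<And>v. v \<in> \<Omega> \<Longrightarrow> r 0 (r 0 v) = v" "\<And>v. v \<in> \<Omega> \<Longrightarrow> r (Suc 0) (r (Suc 0) v) = v"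
      using closed invol assms(1) by auto
    show "r 0 (r (Suc 0) y) = r (Suc 0) (r 0 y)"
      using two r y assms(4) by metis
  qed (use assms in simp)
  then show ?thesis using assms by simp
qed

text \<open>The generators from \<open>r 2\<close> on commute with \<open>r 0\<close>, so they permute its fixed points.\<close>

lemma on_fixed_points:
  "coxeter_action (N - 2) (\<lambda>i. r (i + 2)) {x \<in> \<Omega>. r 0 x = x}"
proof
  fix i x assume i: "Suc i < N - 2" and x: "x \<in> {x \<in> \<Omega>. r 0 x = x}"
  show "r (i + 2) x \<in> {x \<in> \<Omega>. r 0 x = x}"
    using i x far[of 0 "i + 2" x] closed[of "i + 2" x] by auto
  show "r (i + 2) (r (i + 2) x) = x" using i x invol[of "i + 2" x] by auto
next
  fix i x assume "Suc (Suc i) < N - 2" "x \<in> {x \<in> \<Omega>. r 0 x = x}"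
  then show "r (i + 2) (r (Suc i + 2) (r (i + 2) x)) = r (Suc i + 2) (r (i + 2) (r (Suc i + 2) x))"
    using braid[of "i + 2" x] by simp
next
  fix i j x assume "Suc i < j" "Suc j < N - 2" "x \<in> {x \<in> \<Omega>. r 0 x = x}"
  then show "r (i + 2) (r (j + 2) x) = r (j + 2) (r (i + 2) x)"
    using far[of "i + 2" "j + 2" x] by simp
qed

end

text \<open>The generators from \<open>r 2\<close> on also permute the 2-cycles of \<open>r 0\<close>. A linear order on the points
  allows each 2-cycle to be represented by its smaller point, so that the action on the
  2-cycles lives on the same type and the induction below can use its hypothesis for it.\<close>

locale linorder_coxeter_action = coxeter_action N r \<Omega>
  for N and r :: "nat \<Rightarrow> 'a::linorder \<Rightarrow> 'a" and \<Omega>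
begin

definition reps :: "'a set" where "reps = {x \<in> \<Omega>. x < r 0 x}"

definition rep :: "'a \<Rightarrow> 'a" where "rep x = min x (r 0 x)"

lemma rep_in_reps: "2 \<le> N \<Longrightarrow> x \<in> moved 0 \<Longrightarrow> rep x \<in> reps"
  using closed[of 0 x] invol[of 0 x] by (auto simp: reps_def rep_def moved_def min_def)

lemma rep_rep: "2 \<le> N \<Longrightarrow> x \<in> \<Omega> \<Longrightarrow> rep (r 0 x) = rep x"
  using invol[of 0 x] by (auto simp: rep_def min.commute)

lemma rep_reps: "x \<in> reps \<Longrightarrow> rep x = x"
  by (auto simp: reps_def rep_def)

lemma rep_cases: "rep x = x \<or> rep x = r 0 x"
  by (auto simp: rep_def min_def)

lemma moved_far_closed:
  assumes "Suc i < N - 2" "x \<in> moved 0" shows "r (i + 2) x \<in> moved 0"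
proof -
  have x: "x \<in> \<Omega>" "r 0 x \<noteq> x" using assms by (auto simp: moved_def)
  have "r 0 (r (i + 2) x) = r (i + 2) (r 0 x)" using far[of 0 "i + 2" x] assms x by simp
  moreover have "r (i + 2) (r 0 x) \<noteq> r (i + 2) x"
  proof
    assume "r (i + 2) (r 0 x) = r (i + 2) x"
    then have "r (i + 2) (r (i + 2) (r 0 x)) = r (i + 2) (r (i + 2) x)" by (rule arg_cong)
    then show False using x invol[of "i + 2"] closed[of 0 x] assms(1) by simp
  qed
  moreover have "r (i + 2) x \<in> \<Omega>" using closed[of "i + 2" x] assms(1) x by simp
  ultimately show ?thesis by (simp add: moved_def)
qed

lemma rep_step:
  assumes "Suc i < N - 2" "x \<in> moved 0"
  shows "rep (r (i + 2) (rep x)) = rep (r (i + 2) x)"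
proof -
  have x: "x \<in> \<Omega>" using assms by (auto simp: moved_def)
  have "rep (r (i + 2) (r 0 x)) = rep (r (i + 2) x)"
    using far[of 0 "i + 2" x] assms x rep_rep[of "r (i + 2) x"] closed[of "i + 2" x] by auto
  then show ?thesis using rep_cases[of x] by metis
qed

lemma reps_moved: "x \<in> reps \<Longrightarrow> x \<in> moved 0"
  by (auto simp: reps_def moved_def)

lemma on_two_cycles:
  "coxeter_action (N - 2) (\<lambda>i x. rep (r (i + 2) x)) reps"
proof
  fix i x assume i: "Suc i < N - 2" and "x \<in> reps"
  then have x: "x \<in> moved 0" "x \<in> \<Omega>" "rep x = x" by (auto simp: reps_moved reps_def rep_reps)
  show "rep (r (i + 2) x) \<in> reps"
    using rep_in_reps[OF _ moved_far_closed[OF i x(1)]] i by simp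
  show "rep (r (i + 2) (rep (r (i + 2) x))) = x"
    using rep_step[OF i moved_far_closed[OF i x(1)]] i x invol[of "i + 2" x] by simp
next
  fix i x assume i: "Suc (Suc i) < N - 2" and "x \<in> reps"
  then have x: "x \<in> moved 0" "x \<in> \<Omega>" by (auto simp: reps_moved reps_def)
  have i': "Suc i < N - 2" using i by simp
  show "rep (r (i + 2) (rep (r (Suc i + 2) (rep (r (i + 2) x)))))
      = rep (r (Suc i + 2) (rep (r (i + 2) (rep (r (Suc i + 2) x)))))"
    using i x braid[of "i + 2" x] rep_step[OF i'] rep_step[OF i]
      moved_far_closed[OF i'] moved_far_closed[OF i] by simp
next
  fix i j x assume ij: "Suc i < j" "Suc j < N - 2" and "x \<in> reps"
  then have x: "x \<in> moved 0" "x \<in> \<Omega>" by (auto simp: reps_moved reps_def)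
  have i: "Suc i < N - 2" using ij by simp
  show "rep (r (i + 2) (rep (r (j + 2) x))) = rep (r (j + 2) (rep (r (i + 2) x)))"
    using ij x far[of "i + 2" "j + 2" x] rep_step[OF i] rep_step[OF ij(2)]
      moved_far_closed[OF i] moved_far_closed[OF ij(2)] by simp
qed

lemma card_reps:
  assumes "2 \<le> N" "finite \<Omega>"
  shows "card (moved 0) = 2 * card reps"
proof -
  have "moved 0 = reps \<union> r 0 ` reps"
  proof (intro equalityI subsetI)
    fix x assume x: "x \<in> moved 0"
    then have "x \<in> \<Omega>" by (simp add: moved_def)
    then show "x \<in> reps \<union> r 0 ` reps"
      using rep_in_reps[OF assms(1) x] rep_cases[of x] invol[of 0 x] assms(1) by force
  next
    fix x assume "x \<in> reps \<union> r 0 ` reps"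
    then show "x \<in> moved 0" using moved_closed[of 0] reps_moved assms(1) by auto
  qed
  moreover have "inj_on (r 0) reps"
    using invol[of 0] assms(1) by (intro inj_on_inverseI[of _ "r 0"]) (auto simp: reps_def)
  moreover have "reps \<inter> r 0 ` reps = {}"
    using invol[of 0] assms(1) by (fastforce simp: reps_def)
  moreover have "finite reps" using assms(2) by (simp add: reps_def)
  ultimately show ?thesis by (simp add: card_Un_disjoint card_image)
qed

text \<open>If \<open>r 2\<close> and \<open>r 3\<close> induce the same permutation on the fixed points and on the 2-cycles of \<open>r 0\<close>,
  then \<open>t = r 2 \<circ> r 3\<close> maps every point \<open>x\<close> to \<open>x\<close> or \<open>r 0 x\<close>. As \<open>t\<close> commutes with \<open>r 0\<close>, it is an
  involution; but the braid relation says that \<open>t\<close> has order dividing 3.\<close>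

lemma agree_on_fixed_and_cycles_imp_degenerate:
  assumes N: "5 \<le> N"
    and fixed: "\<And>x. x \<in> \<Omega> \<Longrightarrow> r 0 x = x \<Longrightarrow> r 2 x = r 3 x"
    and cycles: "\<And>x. x \<in> reps \<Longrightarrow> rep (r 2 x) = rep (r 3 x)"
  shows degenerate
proof (rule degenerateI[of 2])
  show "\<forall>x\<in>\<Omega>. r 2 x = r (Suc 2) x"
  proof
    fix x assume x: "x \<in> \<Omega>"
    define t where "t y = r 2 (r 3 y)" for y
    have t3: "t (t (t x)) = x"
      using braid[of 2 "r 3 x"] x N invol[of 2] invol[of 3] closed[of 2] closed[of 3]
      by (simp add: t_def numeral_3_eq_3 numeral_2_eq_2)
    have tc: "t (r 0 y) = r 0 (t y)" if "y \<in> \<Omega>" for y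
      using that N far[of 0 2] far[of 0 3] closed[of 3 y] by (simp add: t_def)
    have "t x = x \<or> t x = r 0 x"
    proof (cases "r 0 x = x")
      case True
      then show ?thesis using fixed[OF x] invol[of 2 x] x N by (simp add: t_def)
    next
      case False
      then have m: "x \<in> moved 0" using x by (simp add: moved_def)
      have "rep (r 2 x) = rep (r 3 x)"
        using cycles[OF rep_in_reps[OF _ m]] rep_step[of 0 x] rep_step[of 1 x] m N
        by (simp add: numeral_3_eq_3 numeral_2_eq_2)
      moreover have "r 0 (r 0 (r 2 x)) = r 2 x" "r 0 (r 0 (r 3 x)) = r 3 x"
        using invol[of 0] closed[of 2 x] closed[of 3 x] x N by simp_all
      ultimately have "r 3 x = r 2 x \<or> r 3 x = r 0 (r 2 x)"
        using rep_cases[of "r 2 x"] rep_cases[of "r 3 x"] by metis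
      then show ?thesis using far[of 0 2] invol[of 2] closed[of 0 x] x N by (auto simp: t_def)
    qed
    then have "t (t x) = x"
      using tc[OF x] invol[of 0 x] x N by auto
    then have "t x = x" using t3 by simp
    then show "r 2 x = r (Suc 2) x"
      using invol[of 2 "r 3 x"] closed[of 3 x] x N by (simp add: t_def)
  qed
qed (use N in simp)

end

text \<open>Suppose that \<open>r 0\<close> has \<open>k \<ge> 2\<close> two-cycles. It then has at most \<open>N - 4\<close> fixed points, and
  \<open>k \<le> N / 2\<close>. For \<open>N \<ge> 7\<close> both numbers are below \<open>N - 2\<close>, where the induction hypothesis applies
  and a nondegenerate action is impossible: a chain of transpositions would need \<open>N - 2\<close> points. For
  \<open>N \<le> 6\<close> both numbers are at most 2, except for \<open>k = 3\<close> in degree 6, which is the second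
  alternative of the conclusion. In all other cases \<open>r 2\<close> and \<open>r 3\<close> agree on the fixed points and
  the 2-cycles.\<close>

lemma coxeter_action_small_degree:
  fixes r :: "nat \<Rightarrow> 'a::linorder \<Rightarrow> 'a"
  assumes "coxeter_action N r \<Omega>" "5 \<le> N" "finite \<Omega>" "card \<Omega> \<le> N"
    "\<not> coxeter_action.degenerate N r \<Omega>"
  shows "card (coxeter_action.moved r \<Omega> 0) = 2
    \<or> N = 6 \<and> card \<Omega> = 6 \<and> coxeter_action.moved r \<Omega> 0 = \<Omega>"
  using assms
proof (induction N arbitrary: r \<Omega> rule: less_induct)
  case (less N)
  interpret linorder_coxeter_action N r \<Omega>
    using less.prems(1) by (simp add: linorder_coxeter_action_def)
  let ?F = "{x \<in> \<Omega>. r 0 x = x}"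
  note N = less.prems(2) and fin = less.prems(3) and card = less.prems(4) and nd = less.prems(5)
  \<comment> \<open>What is needed of the action of degree \<open>N - 2\<close>, from the
    induction hypothesis or, in low degree, from having at most two points.\<close>
  have small: "q 0 x = q 1 x"
    if q: "coxeter_action (N - 2) q X" and X: "finite X" "card X \<le> 2 \<or> 7 \<le> N \<and> card X < N - 2"
      and x: "x \<in> X" for q and X :: "'a set" and x
  proof -
    interpret q: coxeter_action "N - 2" q X by fact
    show ?thesis
    proof (cases "card X \<le> 2")
      case True
      then show ?thesis using q.two_points_agree N X x by simp
    next
      case False
      then have N7: "7 \<le> N" "card X < N - 2" using X by auto
      have "q.degenerate"
      proof (rule ccontr)
        assume nd': "\<not> q.degenerate"
        have "card (q.moved 0) = 2 \<or> N - 2 = 6 \<and> card X = 6 \<and> q.moved 0 = X"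
          using less.IH[OF _ q _ X(1) _ nd'] N7 by simp
        then have two: "card (q.moved 0) = 2" using N7 by auto
        have five: "5 \<le> N - 2" using N7 by simp
        have "N - 2 \<le> card X" by (rule q.card_ge_if_transpositions[OF two five nd' X(1)])
        then show False using N7 by simp
      qed
      moreover have "Suc 1 < N - 2" using N7 by simp
      ultimately have "q 1 x = q 0 x" using x unfolding q.degenerate_def by blast
      then show ?thesis by simp
    qed
  qed
  have cm: "card (moved 0) = 2 * card reps" using card_reps fin N by simp
  have split: "card \<Omega> = card (moved 0) + card ?F"
  proof -
    have "\<Omega> = moved 0 \<union> ?F" "moved 0 \<inter> ?F = {}" by (auto simp: moved_def)
    then show ?thesis using card_Un_disjoint[of "moved 0" ?F] fin by (auto simp: moved_def)
  qed
  show ?case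
  proof (rule ccontr)
    assume neg: "\<not> ?thesis"
    have fm: "finite (moved 0)" "finite reps" using fin by (simp_all add: moved_def reps_def)
    have "moved 0 \<noteq> {}" using moved_empty_imp_degenerate nd N by auto
    then have k: "card reps \<noteq> 0" using cm fm by auto
    \<comment> \<open>A single 2-cycle, or three of them without fixed points in degree 6, are the allowed conclusions.\<close>
    have k1: "card reps \<noteq> 1" using neg cm by auto
    have k3: "\<not> (N = 6 \<and> card reps = 3)"
    proof
      assume *: "N = 6 \<and> card reps = 3"
      then have "card \<Omega> = 6" "card (moved 0) = card \<Omega>" using cm split card by auto
      then have "moved 0 = \<Omega>" using card_subset_eq[OF fin, of "moved 0"] by (auto simp: moved_def)
      then show False using neg * \<open>card \<Omega> = 6\<close> by auto
    qed
    have degenerate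
    proof (rule agree_on_fixed_and_cycles_imp_degenerate[OF N])
      fix x assume x: "x \<in> \<Omega>" "r 0 x = x"
      have "card ?F \<le> 2 \<or> 7 \<le> N \<and> card ?F < N - 2"
        using split cm k k1 card N by linarith
      then show "r 2 x = r 3 x" using small[OF on_fixed_points, of x] x fin by (simp add: numeral_3_eq_3 numeral_2_eq_2)
    next
      fix x assume x: "x \<in> reps"
      have "card reps \<le> 2 \<or> 7 \<le> N \<and> card reps < N - 2"
        using split cm k k1 k3 card N by linarith
      then show "rep (r 2 x) = rep (r 3 x)" using small[OF on_two_cycles, of x] x fm by (simp add: numeral_3_eq_3 numeral_2_eq_2)
    qed
    then show False using nd by simp
  qed
qed

section \<open>Homomorphisms out of a presented group\<close>

lemma eval_word_cong:
  assumes "\<And>x. x \<in> X \<Longrightarrow> f x = f' x"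
  shows "w \<in> words X \<Longrightarrow> eval_word G f w = eval_word G f' w"
proof (induction w)
  case (Cons l w)
  then show ?case using assms by (cases l) simp_all
qed simp

text \<open>This reduces statements about a homomorphism \<open>k\<close>, defined on classes of words, to computations with
  the images of the generators; the relations and the uniqueness of \<open>k\<close> follow from it.\<close>

lemma hom_presented_group_class:
  assumes "group G" "k \<in> hom (presented_group X R) G"
  shows "w \<in> words X \<Longrightarrow> k (pres_rel X R `` {w}) = eval_word G (\<lambda>x. k (pres_gen X R x)) w"
proof -
  interpret P: group "presented_group X R" by (rule group_presented_group)
  interpret group_hom "presented_group X R" G k
    by (intro group_hom.intro group_hom_axioms.intro P.is_group assms)
  note cls = presented_group_carrierI[of _ X R]
  show "w \<in> words X \<Longrightarrow> k (pres_rel X R `` {w}) = eval_word G (\<lambda>x. k (pres_gen X R x)) w"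
  proof (induction w)
    case Nil
    then show ?case using hom_one by (simp add: presented_group_one)
  next
    case (Cons l w)
    then have l: "[l] \<in> words X" and w: "w \<in> words X" by simp_all
    have letter: "k (pres_rel X R `` {[l]}) = eval_word G (\<lambda>x. k (pres_gen X R x)) [l]"
    proof (cases l)
      case (Gen x)
      then show ?thesis using hom_closed[OF cls[OF l]] by (simp add: pres_gen_def)
    next
      case (Inv x)
      then have x: "[Gen x] \<in> words X" "x \<in> X" using l by simp_all
      have "([Inv x, Gen x], []) \<in> pres_rel X R"
        using pres_rel.inv_gen[of x X "[]" "[]" R] x by simp
      then have "pres_rel X R `` {[l]} \<otimes>\<^bsub>presented_group X R\<^esub> pres_gen X R x = \<one>\<^bsub>presented_group X R\<^esub>"
        using l x Inv by (simp add: pres_gen_def presented_group_mult presented_group_one pres_class_eq_iff)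
      then have "pres_rel X R `` {[l]} = inv\<^bsub>presented_group X R\<^esub> pres_gen X R x"
        using P.inv_equality cls[OF l] cls[OF x(1)] by (metis pres_gen_def)
      then show ?thesis using Inv cls[OF x(1)] by (simp add: pres_gen_def)
    qed
    have "k (pres_rel X R `` {l # w}) = k (pres_rel X R `` {[l]} \<otimes>\<^bsub>presented_group X R\<^esub> pres_rel X R `` {w})"
      using presented_group_mult[OF l w, of R] by simp
    also have "\<dots> = k (pres_rel X R `` {[l]}) \<otimes>\<^bsub>G\<^esub> k (pres_rel X R `` {w})"
      by (intro hom_mult cls l w)
    also have "\<dots> = eval_word G (\<lambda>x. k (pres_gen X R x)) [l] \<otimes>\<^bsub>G\<^esub> k (pres_rel X R `` {w})"
      by (simp only: letter)
    also have "\<dots> = eval_word G (\<lambda>x. k (pres_gen X R x)) (l # w)"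
    proof -
      have "k (pres_gen X R (base l)) \<in> carrier G"
        using l unfolding pres_gen_def by (intro hom_closed cls) simp
      moreover have "k (pres_rel X R `` {w}) \<in> carrier G" by (intro hom_closed cls w)
      ultimately show ?thesis using Cons by (cases l) simp_all
    qed
    finally show ?case .
  qed
qed

lemma hom_presented_group_relation:
  assumes "group G" "k \<in> hom (presented_group X R) G" "(u, v) \<in> R" "u \<in> words X" "v \<in> words X"
  shows "eval_word G (\<lambda>x. k (pres_gen X R x)) u = eval_word G (\<lambda>x. k (pres_gen X R x)) v"
proof -
  have "(u, v) \<in> pres_rel X R"
    using pres_rel.relation[OF assms(3-5), of "[]" "[]"] by simp
  then have "pres_rel X R `` {u} = pres_rel X R `` {v}"
    using assms(4,5) by (simp add: pres_class_eq_iff)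
  then show ?thesis
    using hom_presented_group_class[OF assms(1,2)] assms(4,5) by metis
qed

lemma hom_presented_group_eqI:
  assumes "group G" "k \<in> hom (presented_group X R) G" "k' \<in> hom (presented_group X R) G"
    and "\<And>x. x \<in> X \<Longrightarrow> k (pres_gen X R x) = k' (pres_gen X R x)"
    and "g \<in> carrier (presented_group X R)"
  shows "k g = k' g"
proof -
  obtain w where w: "w \<in> words X" "g = pres_rel X R `` {w}"
    using assms(5) by (rule presented_group_carrierE)
  then show ?thesis
    using hom_presented_group_class[OF assms(1,2) w(1)] hom_presented_group_class[OF assms(1,3) w(1)]
      eval_word_cong[of X "\<lambda>x. k (pres_gen X R x)" "\<lambda>x. k' (pres_gen X R x)" w G] assms(4) by simp
qed

lemma (in group) commute_inv:
  assumes "c \<in> carrier G" "x \<in> carrier G" "c \<otimes> x = x \<otimes> c"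
  shows "c \<otimes> inv x = inv x \<otimes> c"
proof -
  have "inv x \<otimes> (c \<otimes> x) \<otimes> inv x = inv x \<otimes> c" using assms(1,2) by (simp add: m_assoc)
  moreover have "inv x \<otimes> (x \<otimes> c) \<otimes> inv x = c \<otimes> inv x"
    using assms(1,2) by (simp add: m_assoc[symmetric])
  ultimately show ?thesis using assms(3) by simp
qed

lemma (in group) eval_word_commute:
  assumes c: "c \<in> carrier G" and f: "f \<in> X \<rightarrow> carrier G"
    and comm: "\<And>x. x \<in> X \<Longrightarrow> c \<otimes> f x = f x \<otimes> c"
  shows "w \<in> words X \<Longrightarrow> c \<otimes> eval_word G f w = eval_word G f w \<otimes> c"
proof (induction w)
  case (Cons l w)
  have e: "eval_word G f w \<in> carrier G" using eval_word_closed[OF f] Cons.prems by simp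
  have swap: "c \<otimes> (y \<otimes> eval_word G f w) = y \<otimes> eval_word G f w \<otimes> c"
    if y: "y \<in> carrier G" "c \<otimes> y = y \<otimes> c" for y
  proof -
    have "c \<otimes> (y \<otimes> eval_word G f w) = y \<otimes> (c \<otimes> eval_word G f w)"
      using c e y by (simp add: m_assoc[symmetric])
    then show ?thesis using c e y Cons by (simp add: m_assoc)
  qed
  have x: "base l \<in> X" using Cons.prems by simp
  then have "f (base l) \<in> carrier G" using f by blast
  then show ?case
    using swap comm[OF x] commute_inv[OF c _ comm[OF x]] by (cases l) simp_all
qed (use c in simp)

lemma abelian_hom_presented_group:
  assumes "group G" and k: "k \<in> hom (presented_group X R) G"
    and comm: "\<And>x y. x \<in> X \<Longrightarrow> y \<in> X \<Longrightarrow>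
      k (pres_gen X R x) \<otimes>\<^bsub>G\<^esub> k (pres_gen X R y) = k (pres_gen X R y) \<otimes>\<^bsub>G\<^esub> k (pres_gen X R x)"
  shows "abelian_hom (presented_group X R) G k"
proof -
  interpret tgt: group G by fact
  interpret group_hom "presented_group X R" G k
    by (intro group_hom.intro group_hom_axioms.intro group_presented_group assms)
  let ?f = "\<lambda>x. k (pres_gen X R x)"
  have f: "?f \<in> X \<rightarrow> carrier G"
    by (auto simp: pres_gen_def intro!: hom_closed presented_group_carrierI)
  have gen: "?f x \<in> carrier G" if "x \<in> X" for x using f that by blast
  have half: "?f x \<otimes>\<^bsub>G\<^esub> eval_word G ?f w = eval_word G ?f w \<otimes>\<^bsub>G\<^esub> ?f x" if "x \<in> X" "w \<in> words X" for x w
    using that by (intro tgt.eval_word_commute[OF gen f] comm)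
  have "eval_word G ?f v \<otimes>\<^bsub>G\<^esub> eval_word G ?f w = eval_word G ?f w \<otimes>\<^bsub>G\<^esub> eval_word G ?f v"
    if "v \<in> words X" "w \<in> words X" for v w
    using that by (intro tgt.eval_word_commute[OF tgt.eval_word_closed[OF f] f] half[symmetric])
  then have img: "a \<otimes>\<^bsub>G\<^esub> b = b \<otimes>\<^bsub>G\<^esub> a"
    if "a \<in> k ` carrier (presented_group X R)" "b \<in> k ` carrier (presented_group X R)" for a b
    using that hom_presented_group_class[OF assms(1,2)]
    by (auto elim!: presented_group_carrierE)
  have "group (G\<lparr>carrier := k ` carrier (presented_group X R)\<rparr>)"
    by (rule tgt.subgroup_imp_group[OF img_is_subgroup])
  then have "comm_group (G\<lparr>carrier := k ` carrier (presented_group X R)\<rparr>)"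
    by (rule group.group_comm_groupI) (simp add: img)
  then show ?thesis using k by (simp add: abelian_hom_def)
qed

section \<open>Permutations and fixed-point-free involutions\<close>

lemma transpose_image: "inj f \<Longrightarrow> f (transpose a b x) = transpose (f a) (f b) (f x)"
  by (auto simp: transpose_def inj_eq)

lemma permutes_extending:
  assumes "finite S" "bij_betw a I S" "bij_betw b I S"
  obtains y where "y permutes S" "\<And>i. i \<in> I \<Longrightarrow> y (a i) = b i"
proof
  let ?y = "\<lambda>x. if x \<in> S then b (inv_into I a x) else x"
  have "bij_betw (b \<circ> inv_into I a) S S"
    using bij_betw_trans[OF bij_betw_inv_into[OF assms(2)] assms(3)] .
  then have "bij_betw ?y S S" by (rule bij_betw_cong[THEN iffD1, rotated]) simp
  then show "?y permutes S" by (rule bij_imp_permutes) simp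
  show "?y (a i) = b i" if "i \<in> I" for i
    using that assms(2) bij_betw_inv_into_left[OF assms(2) that] by (auto simp: bij_betw_def)
qed

text \<open>Conjugation by \<open>p\<close> moves the support of a transposition by \<open>p\<close>, so the elements of its
  centraliser preserve the support.\<close>

lemma commuting_transpose_preserves:
  assumes "inj p" "a \<noteq> b" "p \<circ> transpose a b = transpose a b \<circ> p"
  shows "p a \<in> {a, b}" "p b \<in> {a, b}"
proof -
  have b: "p b = transpose a b (p a)" and a: "p a = transpose a b (p b)"
    using assms(3) by (metis comp_apply transpose_apply_first, metis comp_apply transpose_apply_second)
  have ne: "p a \<noteq> p b" using assms(1,2) by (simp add: inj_eq)
  show "p a \<in> {a, b}"
  proof (rule ccontr)
    assume "p a \<notin> {a, b}"
    then have "transpose a b (p a) = p a" by simp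
    then show False using b ne by metis
  qed
  show "p b \<in> {a, b}"
  proof (rule ccontr)
    assume "p b \<notin> {a, b}"
    then have "transpose a b (p b) = p b" by simp
    then show False using a ne by metis
  qed
qed

definition fpf_involutions :: "nat \<Rightarrow> (nat \<Rightarrow> nat) set" where
  "fpf_involutions n = {p. p permutes {1..n} \<and> p \<circ> p = id \<and> (\<forall>x\<in>{1..n}. p x \<noteq> x)}"

lemma fpf_involution_conj_closed:
  assumes "p \<in> fpf_involutions n" "y permutes {1..n}"
  shows "y \<circ> p \<circ> inv' y \<in> fpf_involutions n"
proof -
  have p: "p permutes {1..n}" "\<And>x. p (p x) = x" "\<And>x. x \<in> {1..n} \<Longrightarrow> p x \<noteq> x"
    using assms(1) by (auto simp: fpf_involutions_def fun_eq_iff)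
  note y = permutes_inverses[OF assms(2)]
  have "y \<circ> p \<circ> inv' y permutes {1..n}"
    by (intro permutes_compose permutes_inv p assms(2))
  moreover have "y \<circ> p \<circ> inv' y \<circ> (y \<circ> p \<circ> inv' y) = id"
    by (simp add: fun_eq_iff y p)
  moreover have "(y \<circ> p \<circ> inv' y) x \<noteq> x" if "x \<in> {1..n}" for x
  proof
    assume "(y \<circ> p \<circ> inv' y) x = x"
    then have "inv' y (y (p (inv' y x))) = inv' y x" by simp
    then have "p (inv' y x) = inv' y x" by (simp only: y)
    moreover have "inv' y x \<in> {1..n}" using permutes_in_image[OF permutes_inv[OF assms(2)]] that by simp
    ultimately show False using p(3) by blast
  qed
  ultimately show ?thesis by (simp add: fpf_involutions_def)
qed

text \<open>An enumeration that lists the three 2-cycles one after the other: pick a point, its image, a point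
  not yet listed, and so on.\<close>

lemma fpf_involution_6_pairs:
  assumes "p \<in> fpf_involutions 6"
  obtains a where "bij_betw a {..<6::nat} {1..6}" "\<And>i. i < 3 \<Longrightarrow> p (a (2 * i)) = a (2 * i + 1)"
proof -
  have p: "p permutes {1..6}" "\<And>x. p (p x) = x" "\<And>x. x \<in> {1..6} \<Longrightarrow> p x \<noteq> x"
    using assms by (auto simp: fpf_involutions_def fun_eq_iff)
  have cl: "p x \<in> {1..6}" if "x \<in> {1..6}" for x using permutes_in_image[OF p(1)] that by simp
  have ex: "\<exists>x\<in>{1..6}. x \<notin> set xs" if "length xs < 6" for xs :: "nat list"
  proof (rule ccontr)
    assume "\<not> ?thesis"
    then have "{1..6} \<subseteq> set xs" by blast
    then have "card {1..6::nat} \<le> length xs" using card_mono card_length le_trans by (metis List.finite_set)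
    then show False using that by simp
  qed
  obtain x :: nat where x: "x \<in> {1..6}" using ex[of "[]"] by auto
  obtain z where z: "z \<in> {1..6}" "z \<noteq> x" "z \<noteq> p x" using ex[of "[x, p x]"] by auto
  obtain w where w: "w \<in> {1..6}" "w \<noteq> x" "w \<noteq> p x" "w \<noteq> z" "w \<noteq> p z"
    using ex[of "[x, p x, z, p z]"] by auto
  let ?l = "[x, p x, z, p z, w, p w]"
  have "p z \<noteq> x" "p w \<noteq> x" "p w \<noteq> z" "p z \<noteq> p x" "p w \<noteq> p x" "p w \<noteq> p z"
    using z w p(2) by metis+
  then have "distinct ?l" using z w p(3)[OF x] p(3)[OF z(1)] p(3)[OF w(1)] by auto
  moreover have "set ?l = {1..6}"
  proof (rule card_subset_eq)
    show "set ?l \<subseteq> {1..6}" using x z w cl by simp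
    show "card (set ?l) = card {1..6::nat}" using distinct_card[OF \<open>distinct ?l\<close>] by simp
  qed simp
  ultimately have "bij_betw ((!) ?l) {..<6} {1..6}"
    by (intro bij_betw_nth) auto
  moreover have "p (?l ! (2 * i)) = ?l ! (2 * i + 1)" if "i < 3" for i
  proof -
    have "i = 0 \<or> i = 1 \<or> i = 2" using that by linarith
    then show ?thesis by (elim disjE) simp_all
  qed
  ultimately show ?thesis by (rule that)
qed

text \<open>Matching the enumerations by 2-cycles of both involutions yields a conjugating permutation.\<close>

lemma fpf_involutions_6_conjugate:
  assumes "p \<in> fpf_involutions 6" "q \<in> fpf_involutions 6"
  obtains y where "y permutes {1..6}" "q = y \<circ> p \<circ> inv' y"
proof -
  obtain a where a: "bij_betw a {..<6::nat} {1..6}" "\<And>i. i < 3 \<Longrightarrow> p (a (2 * i)) = a (2 * i + 1)"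
    using fpf_involution_6_pairs[OF assms(1)] by blast
  obtain b where b: "bij_betw b {..<6::nat} {1..6}" "\<And>i. i < 3 \<Longrightarrow> q (b (2 * i)) = b (2 * i + 1)"
    using fpf_involution_6_pairs[OF assms(2)] by blast
  obtain y where y: "y permutes {1..6}" "\<And>i. i \<in> {..<6} \<Longrightarrow> y (a i) = b i"
    using permutes_extending[OF _ a(1) b(1)] by auto
  have p: "p permutes {1..6}" "\<And>x. p (p x) = x" and q: "q permutes {1..6}" "\<And>x. q (q x) = x"
    using assms by (auto simp: fpf_involutions_def fun_eq_iff)
  have "y (p x) = q (y x)" for x
  proof (cases "x \<in> {1..6}")
    case True
    then have "x \<in> a ` {..<6}" using a(1) by (simp add: bij_betw_def)
    then obtain i where i: "x = a i" "i < 6" by auto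
    define j where "j = i div 2"
    have j: "j < 3" using i(2) unfolding j_def by linarith
    have ji: "2 * j \<in> {..<6}" "2 * j + 1 \<in> {..<6}" using j by simp_all
    have odd: "p (a (2 * j + 1)) = a (2 * j)" "q (b (2 * j + 1)) = b (2 * j)"
      using a(2)[OF j] b(2)[OF j] p(2) q(2) by metis+
    have "i = 2 * j \<or> i = 2 * j + 1" unfolding j_def by linarith
    then show ?thesis
    proof
      assume "i = 2 * j"
      then show ?thesis by (simp only: i(1) a(2)[OF j] b(2)[OF j] y(2)[OF ji(1)] y(2)[OF ji(2)])
    next
      assume "i = 2 * j + 1"
      then show ?thesis by (simp only: i(1) odd y(2)[OF ji(1)] y(2)[OF ji(2)])
    qed
  next
    case False
    then show ?thesis
      using permutes_not_in[OF p(1)] permutes_not_in[OF q(1)] permutes_not_in[OF y(1)] by metis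
  qed
  then have "q = y \<circ> p \<circ> inv' y"
    by (simp add: fun_eq_iff permutes_inverses[OF y(1)])
  then show ?thesis using y(1) that by blast
qed

section \<open>Homomorphisms from the unrestricted virtual braid group\<close>

text \<open>Generation by adjacent transpositions, as an induction principle. The transposition of \<open>a\<close> and
  \<open>b + 1\<close> is the conjugate of that of \<open>a\<close> and \<open>b\<close> by that of \<open>b\<close> and \<open>b + 1\<close>.\<close>

lemma adjacent_transpositions_generate:
  assumes one: "P id" and comp: "\<And>p q. P p \<Longrightarrow> P q \<Longrightarrow> P (p \<circ> q)"
    and adj: "\<And>i. i \<in> {1..n - 1} \<Longrightarrow> P (transpose i (i + 1))"
    and p: "p permutes {1..n::nat}"
  shows "P p"
proof -
  have less: "P (transpose a b)" if "a < b" "1 \<le> a" "b \<le> n" for a b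
  proof -
    have "Suc a \<le> b" using that by simp
    then show ?thesis using that(2,3)
    proof (induction b rule: dec_induct)
      case base
      then show ?case using adj[of a] by simp
    next
      case (step b)
      have "P (transpose b (Suc b) \<circ> (transpose a b \<circ> transpose b (Suc b)))"
        using step adj[of b] by (intro comp) simp_all
      moreover have "transpose b (Suc b) \<circ> (transpose a b \<circ> transpose b (Suc b)) = transpose a (Suc b)"
        using step(1) by (auto simp: fun_eq_iff transpose_def)
      ultimately show ?case by simp
    qed
  qed
  show ?thesis using p finite_atLeastAtMost
  proof (induction p rule: permutes_induct)
    case id
    show ?case by (rule one)
  next
    case (swap a b p)
    have "P (transpose a b)"
    proof (cases "a < b")
      case True
      then show ?thesis using less swap.hyps by simp
    next
      case False
      then have "b < a" using swap.hyps by simp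
      then show ?thesis using less[of b a] swap.hyps by (simp add: transpose_commute)
    qed
    then show ?case using swap.IH comp by blast
  qed
qed

lemma phi_surj:
  assumes "p permutes {1..n}"
  shows "\<exists>g\<in>carrier (UVB n). phi n g = p"
proof (rule adjacent_transpositions_generate[OF _ _ _ assms])
  interpret group_hom "UVB n" "sym_group n" "phi n"
    by (intro group_hom.intro group_hom_axioms.intro group_UVB sym_group_is_group phi_hom)
  show "\<exists>g\<in>carrier (UVB n). phi n g = id"
    using hom_one G.one_closed by (metis sym_group_one)
  show "\<exists>g\<in>carrier (UVB n). phi n g = p \<circ> q"
    if "\<exists>g\<in>carrier (UVB n). phi n g = p" "\<exists>g\<in>carrier (UVB n). phi n g = q" for p q
  proof -
    obtain a b where "a \<in> carrier (UVB n)" "phi n a = p" "b \<in> carrier (UVB n)" "phi n b = q"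
      using \<open>\<exists>g\<in>carrier (UVB n). phi n g = p\<close> \<open>\<exists>g\<in>carrier (UVB n). phi n g = q\<close> by blast
    then show ?thesis using hom_mult[of a b] G.m_closed[of a b] by (metis sym_group_mult)
  qed
  show "\<exists>g\<in>carrier (UVB n). phi n g = transpose i (i + 1)" if i: "i \<in> {1..n - 1}" for i
  proof
    show "phi n (uvb_elem n (Rho i)) = transpose i (i + 1)" by (rule phi_generators(2)[OF i])
    show "uvb_elem n (Rho i) \<in> carrier (UVB n)"
      unfolding uvb_elem_def pres_gen_def UVB_def
      using i by (intro presented_group_carrierI) (simp add: uvb_gens_def)
  qed
qed

lemma conjugate_hom_sym_group:
  assumes "h \<in> hom G (sym_group n)" "y permutes {1..n}"
  shows "(\<lambda>g. y \<circ> h g \<circ> inv' y) \<in> hom G (sym_group n)"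
proof (rule homI)
  have cl: "h g permutes {1..n}" if "g \<in> carrier G" for g
    using hom_in_carrier[OF assms(1) that] by (simp only: sym_group_carrier)
  show "y \<circ> h g \<circ> inv' y \<in> carrier (sym_group n)" if "g \<in> carrier G" for g
    unfolding sym_group_carrier by (intro permutes_compose permutes_inv cl that assms(2))
  show "y \<circ> h (g \<otimes>\<^bsub>G\<^esub> g') \<circ> inv' y = (y \<circ> h g \<circ> inv' y) \<otimes>\<^bsub>sym_group n\<^esub> (y \<circ> h g' \<circ> inv' y)"
    if "g \<in> carrier G" "g' \<in> carrier G" for g g'
    using hom_mult[OF assms(1) that]
    by (simp add: sym_group_mult fun_eq_iff permutes_inverses[OF assms(2)])
qed

lemma hom_sym_group_conjugate:
  assumes v: "v \<in> hom (sym_group m) (sym_group n)" and y: "y permutes {1..m}" and p: "p permutes {1..m}"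
  shows "v (y \<circ> p \<circ> inv' y) = v y \<circ> v p \<circ> inv' (v y)"
proof -
  interpret group_hom "sym_group m" "sym_group n" v
    using v by (intro group_hom.intro group_hom_axioms.intro sym_group_is_group)
  have yc: "y \<in> carrier (sym_group m)" and pc: "p \<in> carrier (sym_group m)"
    using y p by (simp_all only: sym_group_carrier)
  have "v (y \<otimes>\<^bsub>sym_group m\<^esub> p \<otimes>\<^bsub>sym_group m\<^esub> inv\<^bsub>sym_group m\<^esub> y)
      = v y \<otimes>\<^bsub>sym_group n\<^esub> v p \<otimes>\<^bsub>sym_group n\<^esub> inv\<^bsub>sym_group n\<^esub> v y"
    using yc pc by (simp del: sym_group_inv_equality)
  then show ?thesis by (simp add: sym_group_mult yc hom_closed)
qed

lemma conjugate_homsI: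
  assumes "h \<in> hom G (sym_group n)" "y permutes {1..n}"
  shows "conjugate_homs G (sym_group n) h (\<lambda>g. y \<circ> h g \<circ> inv' y)"
  unfolding conjugate_homs_def
  using assms conjugate_hom_sym_group[OF assms]
  by (auto simp: sym_group_mult sym_group_carrier intro!: bexI[of _ y])

locale uvb_hom =
  fixes n :: nat and h :: "uvb_gen word set \<Rightarrow> nat \<Rightarrow> nat"
  assumes n: "5 \<le> n" and hom: "h \<in> hom (UVB n) (sym_group n)"
begin

definition s :: "nat \<Rightarrow> nat \<Rightarrow> nat" where "s i = h (uvb_elem n (Sigma i))"
definition t :: "nat \<Rightarrow> nat \<Rightarrow> nat" where "t i = h (uvb_elem n (Rho i))"

lemma gens: "i \<in> {1..n - 1} \<Longrightarrow> Sigma i \<in> uvb_gens n" "i \<in> {1..n - 1} \<Longrightarrow> Rho i \<in> uvb_gens n"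
  by (simp_all add: uvb_gens_def)

lemma gen_permutes: "x \<in> uvb_gens n \<Longrightarrow> h (uvb_elem n x) permutes {1..n}"
  using hom_in_carrier[OF hom, of "uvb_elem n x"] presented_group_carrierI[of "[Gen x]" "uvb_gens n" "uvb_rels n"]
  by (simp add: sym_group_carrier UVB_def uvb_elem_def pres_gen_def)

lemma s_permutes: "i \<in> {1..n - 1} \<Longrightarrow> s i permutes {1..n}"
  and t_permutes: "i \<in> {1..n - 1} \<Longrightarrow> t i permutes {1..n}"
  unfolding s_def t_def by (intro gen_permutes gens; assumption)+

lemma relation:
  assumes "(u, v) \<in> uvb_rels n" "u \<in> words (uvb_gens n)" "v \<in> words (uvb_gens n)"
  shows "eval_word (sym_group n) (\<lambda>x. h (uvb_elem n x)) u = eval_word (sym_group n) (\<lambda>x. h (uvb_elem n x)) v"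
  unfolding uvb_elem_def
  by (rule hom_presented_group_relation[OF sym_group_is_group hom[unfolded UVB_def] assms])

lemma t_braid:
  assumes "i \<in> {1..n - 2}" shows "t i \<circ> (t (i + 1) \<circ> t i) = t (i + 1) \<circ> (t i \<circ> t (i + 1))"
proof -
  have i: "i \<in> {1..n - 1}" "i + 1 \<in> {1..n - 1}" using assms n by auto
  have "([rh i, rh (i+1), rh i], [rh (i+1), rh i, rh (i+1)]) \<in> uvb_rels n"
    using assms unfolding uvb_rels_def by blast
  from relation[OF this] show ?thesis
    using gens[OF i(1)] gens[OF i(2)] by (simp add: t_def sym_group_mult sym_group_one)
qed

lemma t_far:
  assumes "i \<in> {1..n - 1}" "j \<in> {1..n - 1}" "\<bar>int i - int j\<bar> > 1" shows "t i \<circ> t j = t j \<circ> t i"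
proof -
  have "([rh i, rh j], [rh j, rh i]) \<in> uvb_rels n"
    using assms unfolding uvb_rels_def by blast
  from relation[OF this] show ?thesis
    using gens[OF assms(1)] gens[OF assms(2)] by (simp add: t_def sym_group_mult sym_group_one)
qed

lemma t_invol:
  assumes "i \<in> {1..n - 1}" shows "t i \<circ> t i = id"
proof -
  have "([rh i, rh i], []) \<in> uvb_rels n"
    using assms unfolding uvb_rels_def by blast
  from relation[OF this] show ?thesis
    using gens[OF assms] by (simp add: t_def sym_group_mult sym_group_one)
qed

lemma s_t_far:
  assumes "i \<in> {1..n - 1}" "j \<in> {1..n - 1}" "\<bar>int i - int j\<bar> > 1" shows "s i \<circ> t j = t j \<circ> s i"
proof -
  have "([sg i, rh j], [rh j, sg i]) \<in> uvb_rels n"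
    using assms unfolding uvb_rels_def by blast
  from relation[OF this] show ?thesis
    using gens[OF assms(1)] gens[OF assms(2)] by (simp add: t_def s_def sym_group_mult sym_group_one)
qed

lemma s_t_t:
  assumes "i \<in> {1..n - 2}" shows "s i \<circ> (t (i + 1) \<circ> t i) = t (i + 1) \<circ> (t i \<circ> s (i + 1))"
proof -
  have i: "i \<in> {1..n - 1}" "i + 1 \<in> {1..n - 1}" using assms n by auto
  have "([sg i, rh (i+1), rh i], [rh (i+1), rh i, sg (i+1)]) \<in> uvb_rels n"
    using assms unfolding uvb_rels_def by blast
  from relation[OF this] show ?thesis
    using gens[OF i(1)] gens[OF i(2)] by (simp add: t_def s_def sym_group_mult sym_group_one)
qed

lemma t_s_s:
  assumes "i \<in> {1..n - 2}" shows "t i \<circ> (s (i + 1) \<circ> s i) = s (i + 1) \<circ> (s i \<circ> t (i + 1))"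
proof -
  have i: "i \<in> {1..n - 1}" "i + 1 \<in> {1..n - 1}" using assms n by auto
  have "([rh i, sg (i+1), sg i], [sg (i+1), sg i, rh (i+1)]) \<in> uvb_rels n"
    using assms unfolding uvb_rels_def by blast
  from relation[OF this] show ?thesis
    using gens[OF i(1)] gens[OF i(2)] by (simp add: t_def s_def sym_group_mult sym_group_one)
qed

lemma coxeter: "coxeter_action n (\<lambda>i. t (Suc i)) {1..n}"
proof
  fix i x assume i: "Suc i < n" and x: "x \<in> {1..n}"
  then have i': "Suc i \<in> {1..n - 1}" by auto
  show "t (Suc i) x \<in> {1..n}" using permutes_in_image[OF t_permutes[OF i']] x by blast
  show "t (Suc i) (t (Suc i) x) = x" using fun_cong[OF t_invol[OF i'], of x] by simp
next
  fix i x assume "Suc (Suc i) < n"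
  then have "Suc i \<in> {1..n - 2}" by auto
  from fun_cong[OF t_braid[OF this], of x]
  show "t (Suc i) (t (Suc (Suc i)) (t (Suc i) x)) = t (Suc (Suc i)) (t (Suc i) (t (Suc (Suc i)) x))"
    by simp
next
  fix i j x assume "Suc i < j" "Suc j < n"
  then have "t (Suc i) \<circ> t (Suc j) = t (Suc j) \<circ> t (Suc i)" by (intro t_far) auto
  from fun_cong[OF this, of x]
  show "t (Suc i) (t (Suc j) x) = t (Suc j) (t (Suc i) x)" by simp
qed

sublocale cox: coxeter_action n "\<lambda>i. t (Suc i)" "{1..n}" by (rule coxeter)

lemma eq_on_generators_eq:
  assumes "h' \<in> hom (UVB n) (sym_group n)" "g \<in> carrier (UVB n)"
    and "\<And>i. i \<in> {1..n - 1} \<Longrightarrow> s i = h' (uvb_elem n (Sigma i))"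
    and "\<And>i. i \<in> {1..n - 1} \<Longrightarrow> t i = h' (uvb_elem n (Rho i))"
  shows "h g = h' g"
proof (rule hom_presented_group_eqI[OF sym_group_is_group hom[unfolded UVB_def]
      assms(1)[unfolded UVB_def] _ assms(2)[unfolded UVB_def]])
  fix x assume "x \<in> uvb_gens n"
  then have "h (uvb_elem n x) = h' (uvb_elem n x)"
    using assms(3,4) unfolding uvb_gens_def s_def t_def by blast
  then show "h (pres_gen (uvb_gens n) (uvb_rels n) x) = h' (pres_gen (uvb_gens n) (uvb_rels n) x)"
    by (simp add: uvb_elem_def)
qed

text \<open>When all \<open>t i\<close> are one involution, the relation \<open>s_t_t\<close> becomes \<open>s i = s (i + 1)\<close>, and \<open>s 1\<close>
  commutes with \<open>t 3 = t 1\<close>.\<close>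

lemma abelian_if_t_agree:
  assumes "t 1 = t 2"
  shows "abelian_hom (UVB n) (sym_group n) h"
proof -
  have "cox.degenerate"
    by (rule cox.degenerateI[of 0]) (use n assms in \<open>simp_all add: numeral_2_eq_2\<close>)
  have t: "t i = t 1" if i: "i \<in> {1..n - 1}" for i
  proof
    fix x
    show "t i x = t 1 x"
    proof (cases "x \<in> {1..n}")
      case True
      have "i \<noteq> 0" "i < n" using i by auto
      then obtain j where j: "i = Suc j" "Suc j < n" by (metis not0_implies_Suc)
      have "t (Suc j) x = t (Suc 0) x"
        using \<open>cox.degenerate\<close> j(2) True unfolding cox.degenerate_def by blast
      then show ?thesis by (simp add: j(1))
    next
      case False
      have "1 \<in> {1..n - 1}" using n by simp
      then show ?thesis
        using permutes_not_in[OF t_permutes[OF i] False] permutes_not_in[OF t_permutes False] by simp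
    qed
  qed
  have tt: "t 1 \<circ> t 1 = id" using t_invol[of 1] n by simp
  have s: "s i = s 1" if i: "i \<in> {1..n - 1}" for i
  proof -
    have "1 \<le> i" using i by simp
    then show ?thesis using i
    proof (induction i rule: dec_induct)
      case (step i)
      then have i: "i \<in> {1..n - 2}" "i \<in> {1..n - 1}" "i + 1 \<in> {1..n - 1}" by auto
      have "s i \<circ> (t 1 \<circ> t 1) = (t 1 \<circ> t 1) \<circ> s (i + 1)"
        using s_t_t[OF i(1)] by (simp only: t[OF i(2)] t[OF i(3)] comp_assoc)
      then show ?case using step.IH[OF i(2)] by (simp only: tt comp_id id_comp Suc_eq_plus1)
    qed simp
  qed
  have "s 1 \<circ> t 3 = t 3 \<circ> s 1" using n by (intro s_t_far) auto
  then have st: "s 1 \<circ> t 1 = t 1 \<circ> s 1" using t[of 3] n by simp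
  have val: "h (uvb_elem n x) = s 1 \<or> h (uvb_elem n x) = t 1" if "x \<in> uvb_gens n" for x
    using that unfolding uvb_gens_def
  proof (elim UnE imageE)
    fix i assume "x = Sigma i" "i \<in> {1..n - 1}"
    then show ?thesis using s[of i] unfolding s_def by metis
  next
    fix i assume "x = Rho i" "i \<in> {1..n - 1}"
    then show ?thesis using t[of i] unfolding t_def by metis
  qed
  have "h (uvb_elem n x) \<circ> h (uvb_elem n y) = h (uvb_elem n y) \<circ> h (uvb_elem n x)"
    if "x \<in> uvb_gens n" "y \<in> uvb_gens n" for x y
    using val[OF that(1)] val[OF that(2)] st by (elim disjE) simp_all
  then show ?thesis
    using abelian_hom_presented_group[OF sym_group_is_group hom[unfolded UVB_def]]
    by (simp add: UVB_def sym_group_mult uvb_elem_def)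
qed

text \<open>\<open>s 1\<close> commutes with the transpositions \<open>(3, 4), (4, 5), \<dots>\<close>. It preserves the supports of these, and
  since \<open>n \<ge> 5\<close> the overlapping supports force it to fix every point from 3 on; so it is trivial or
  \<open>(1, 2)\<close>. By \<open>s_t_t\<close> all \<open>s i\<close> are conjugates of \<open>s 1\<close> by known permutations. If they were trivial,
  the relation \<open>t_s_s\<close> would read \<open>t 1 = t 2\<close>.\<close>

lemma s_determined:
  assumes t: "\<And>i. i \<in> {1..n - 1} \<Longrightarrow> t i = transpose i (i + 1)" and i: "i \<in> {1..n - 1}"
  shows "s i = transpose i (i + 1)"
proof -
  have 1: "1 \<in> {1..n - 1}" using n by simp
  have s1: "s 1 permutes {1..n}" by (rule s_permutes[OF 1])
  note inj = permutes_inj[OF s1]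
  have pair: "s 1 j \<in> {j, j + 1}" "s 1 (j + 1) \<in> {j, j + 1}" if "j \<in> {3..n - 1}" for j
  proof -
    have "s 1 \<circ> t j = t j \<circ> s 1" using that by (intro s_t_far) auto
    then have "s 1 \<circ> transpose j (j + 1) = transpose j (j + 1) \<circ> s 1" using t[of j] that by simp
    from commuting_transpose_preserves[OF inj _ this]
    show "s 1 j \<in> {j, j + 1}" "s 1 (j + 1) \<in> {j, j + 1}" by simp_all
  qed
  have mid: "s 1 j = j" if j: "j \<in> {4..n - 1}" for j
  proof -
    have "j - 1 \<in> {3..n - 1}" "j \<in> {3..n - 1}" "j - 1 + 1 = j" using j by auto
    then have "s 1 j \<in> {j - 1, j}" "s 1 j \<in> {j, j + 1}" using pair(2)[of "j - 1"] pair(1)[of j] by simp_all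
    then show ?thesis by auto
  qed
  have "s 1 3 = 3"
  proof -
    have "s 1 3 \<in> {3, 4}" "s 1 4 = 4" using pair(1)[of 3] mid[of 4] n by simp_all
    then show ?thesis using inj_eq[OF inj, of 3 4] by auto
  qed
  moreover have "s 1 n = n"
  proof -
    have "n - 1 + 1 = n" "n \<noteq> n - 1" using n by simp_all
    then have "s 1 n \<in> {n - 1, n}" "s 1 (n - 1) = n - 1" using pair(2)[of "n - 1"] mid[of "n - 1"] n by simp_all
    then show ?thesis using inj_eq[OF inj, of n "n - 1"] \<open>n \<noteq> n - 1\<close> by auto
  qed
  ultimately have big: "s 1 j = j" if "j \<in> {3..n}" for j
    using mid[of j] that by (cases "j = 3 \<or> j = n") auto
  have out: "s 1 j = j" if "j \<notin> {1, 2}" for j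
    using big[of j] permutes_not_in[OF s1, of j] that by (cases "j \<in> {1..n}") auto
  have in12: "s 1 j \<in> {1, 2}" if "j \<in> {1, 2}" for j
  proof (rule ccontr)
    assume *: "s 1 j \<notin> {1, 2}"
    then have "s 1 j = j" using out[OF *] inj_eq[OF inj] by blast
    then show False using * that by simp
  qed
  have ne12: "s 1 1 \<noteq> s 1 2" using inj_eq[OF inj, of 1 2] by simp
  have cases: "s 1 = id \<or> s 1 = transpose 1 2"
  proof (cases "s 1 1 = 1")
    case True
    then have "s 1 2 = 2" using in12[of 2] ne12 by auto
    then have "s 1 j = j" for j using True out[of j] by blast
    then show ?thesis by (simp add: fun_eq_iff)
  next
    case False
    then have "s 1 1 = 2" "s 1 2 = 1" using in12[of 1] in12[of 2] ne12 by auto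
    then have "s 1 j = transpose 1 2 j" for j
      using out[of j] by (cases "j \<in> {1, 2}") (auto simp: transpose_def)
    then show ?thesis by (simp add: fun_eq_iff)
  qed
  have s_next: "s (i + 1) = t i \<circ> (t (i + 1) \<circ> (s i \<circ> (t (i + 1) \<circ> t i)))" if "i \<in> {1..n - 2}" for i
  proof -
    have "t i \<circ> t i = id" "t (i + 1) \<circ> t (i + 1) = id" using that by (auto intro!: t_invol)
    then show ?thesis unfolding s_t_t[OF that] by (metis comp_assoc id_comp)
  qed
  show ?thesis
  proof (rule disjE[OF cases])
    assume "s 1 = id"
    moreover have "s 2 = t 1 \<circ> (t 2 \<circ> (s 1 \<circ> (t 2 \<circ> t 1)))" using s_next[of 1] n by (simp add: numeral_2_eq_2)
    moreover have "t 1 \<circ> t 1 = id" "t 2 \<circ> t 2 = id" using n by (auto intro!: t_invol)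
    ultimately have "s 1 = id" "s 2 = id" by (metis comp_assoc id_comp)+
    then have "t 1 = t 2" using t_s_s[of 1] n by (simp add: numeral_2_eq_2)
    then have "transpose 1 2 = (transpose 2 3 :: nat \<Rightarrow> nat)" using t[of 1] t[of 2] n by (simp add: numeral_eq_Suc)
    then have "transpose 1 2 (1::nat) = transpose 2 3 1" by simp
    then show ?thesis by (simp add: transpose_def)
  next
    assume s1: "s 1 = transpose 1 2"
    have "1 \<le> i" using i by simp
    then show ?thesis using i
    proof (induction i rule: dec_induct)
      case base
      then show ?case using s1 by (simp add: numeral_2_eq_2)
    next
      case (step i)
      then have i: "i \<in> {1..n - 2}" "i \<in> {1..n - 1}" "i + 1 \<in> {1..n - 1}" by auto
      have "s (i + 1) = t i \<circ> (t (i + 1) \<circ> (t i \<circ> (t (i + 1) \<circ> t i)))"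
        using s_next[OF i(1)] step.IH[OF i(2)] t[OF i(2)] by simp
      also have "\<dots> = t (i + 1)"
        using t_braid[OF i(1)] t_invol[OF i(2)] t_invol[OF i(3)] by (metis comp_assoc id_comp comp_id)
      finally show ?case using t[OF i(3)] by simp
    qed
  qed
qed

lemma is_phi_if_t_standard:
  assumes "\<And>i. i \<in> {1..n - 1} \<Longrightarrow> t i = transpose i (i + 1)" "g \<in> carrier (UVB n)"
  shows "h g = phi n g"
  using assms s_determined phi_generators by (intro eq_on_generators_eq phi_hom) simp_all

end

text \<open>The classification of small Coxeter actions, applied to \<open>t\<close>. In the case of transpositions the
  chain \<open>a\<close> exhausts \<open>{1..n}\<close>, and the permutation that sends \<open>a i\<close> to \<open>i + 1\<close> conjugates \<open>h\<close> into
  standard form.\<close>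

lemma nonabelian_uvb_hom_cases:
  assumes n: "5 \<le> n" and h: "h \<in> hom (UVB n) (sym_group n)"
    and ne: "h (uvb_elem n (Rho 1)) \<noteq> h (uvb_elem n (Rho 2))"
  shows "(\<exists>y. y permutes {1..n} \<and> (\<forall>g\<in>carrier (UVB n). y \<circ> h g \<circ> inv' y = phi n g))
    \<or> n = 6 \<and> h (uvb_elem n (Rho 1)) \<in> fpf_involutions 6"
proof -
  interpret uvb_hom n h using n h by (simp add: uvb_hom_def)
  have nd: "\<not> cox.degenerate"
  proof
    assume d: "cox.degenerate"
    have "t 2 x = t 1 x" for x
    proof (cases "x \<in> {1..n}")
      case True
      have "Suc 1 < n" using n by simp
      then have "t (Suc 1) x = t (Suc 0) x" using d True unfolding cox.degenerate_def by blast
      then show ?thesis by (simp add: numeral_2_eq_2)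
    next
      case False
      have "1 \<in> {1..n - 1}" "2 \<in> {1..n - 1}" using n by simp_all
      then show ?thesis
        using permutes_not_in[OF t_permutes False] by simp
    qed
    then show False using ne by (auto simp: t_def)
  qed
  from coxeter_action_small_degree[OF coxeter n _ _ nd]
  consider "card (cox.moved 0) = 2" | "n = 6" "cox.moved 0 = {1..n}" by auto
  then show ?thesis
  proof cases
    case 1
    obtain a where a: "inj_on a {..<n}" "a ` {..<n} \<subseteq> {1..n}"
      and ta: "\<And>i x. Suc i < n \<Longrightarrow> x \<in> {1..n} \<Longrightarrow> t (Suc i) x = transpose (a i) (a (Suc i)) x"
      by (rule cox.transposition_chain[OF 1 n nd]) blast
    have "a ` {..<n} = {1..n}"
      using a by (intro card_subset_eq) (simp_all add: card_image)
    with a(1) have ba: "bij_betw a {..<n} {1..n}" by (simp add: bij_betw_def)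
    have bs: "bij_betw Suc {..<n} {1..n}"
      by (rule bij_betw_byWitness[where f' = "\<lambda>i. i - 1"]) auto
    obtain y where y: "y permutes {1..n}" "\<And>i. i \<in> {..<n} \<Longrightarrow> y (a i) = Suc i"
      using permutes_extending[OF _ ba bs] by auto
    interpret k: uvb_hom n "\<lambda>g. y \<circ> h g \<circ> inv' y"
      using n conjugate_hom_sym_group[OF h y(1)] by (simp add: uvb_hom_def)
    have "k.t i = transpose i (i + 1)" if i: "i \<in> {1..n - 1}" for i
    proof
      fix x
      have "i \<noteq> 0" "i < n" using i by auto
      then obtain j where j: "i = Suc j" "Suc j < n" by (metis not0_implies_Suc)
      show "k.t i x = transpose i (i + 1) x"
      proof (cases "x \<in> {1..n}")
        case True
        then have "inv' y x \<in> {1..n}" using permutes_in_image[OF permutes_inv[OF y(1)]] by blast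
        then have "k.t i x = y (transpose (a j) (a (Suc j)) (inv' y x))"
          using ta[OF j(2)] j(1) unfolding k.t_def t_def by simp
        also have "\<dots> = transpose (Suc j) (Suc (Suc j)) x"
          using y(2)[of j] y(2)[of "Suc j"] j(2)
          by (simp add: transpose_image[OF permutes_inj[OF y(1)]] permutes_inverses[OF y(1)])
        finally show ?thesis using j by simp
      next
        case False
        then have "x \<noteq> i" "x \<noteq> i + 1" using i by auto
        then show ?thesis using permutes_not_in[OF k.t_permutes[OF i] False] by simp
      qed
    qed
    then have "\<forall>g\<in>carrier (UVB n). y \<circ> h g \<circ> inv' y = phi n g"
      using k.is_phi_if_t_standard by blast
    then show ?thesis using y(1) by blast
  next
    case 2
    have "t 1 permutes {1..n}" "t 1 \<circ> t 1 = id" using t_permutes t_invol n by simp_all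
    moreover have "\<forall>x\<in>{1..n}. t 1 x \<noteq> x" using 2(2) unfolding cox.moved_def by auto
    ultimately have "t 1 \<in> fpf_involutions n" by (simp add: fpf_involutions_def)
    then have "h (uvb_elem n (Rho 1)) \<in> fpf_involutions n" unfolding t_def .
    then show ?thesis using 2(1) by simp
  qed
qed


section \<open>Outer automorphisms in degree six\<close>

text \<open>Otherwise \<open>v \<circ> \<phi>\<close> would be conjugate to \<open>\<phi>\<close>, and \<open>v\<close> would be inner because \<open>\<phi>\<close> is surjective.\<close>

lemma outer_automorphism_6_transposition_fpf:
  assumes v: "outer_automorphism (sym_group 6) v"
  shows "v (transpose 1 2) \<in> fpf_involutions 6"
proof -
  have iso: "v \<in> iso (sym_group 6) (sym_group 6)" and outer: "\<not> inner_automorphism (sym_group 6) v"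
    using v by (auto simp: outer_automorphism_def)
  then have hom: "v \<in> hom (sym_group 6) (sym_group 6)" and inj: "inj_on v (carrier (sym_group 6))"
    by (auto simp: iso_def bij_betw_def)
  have vphi: "v \<circ> phi 6 \<in> hom (UVB 6) (sym_group 6)" by (rule hom_compose[OF phi_hom hom])
  have gens: "(v \<circ> phi 6) (uvb_elem 6 (Rho 1)) = v (transpose 1 2)"
    "(v \<circ> phi 6) (uvb_elem 6 (Rho 2)) = v (transpose 2 3)"
    using phi_generators(2)[of 1 6] phi_generators(2)[of 2 6] by (simp_all add: numeral_eq_Suc)
  have "v (transpose 1 2) \<noteq> v (transpose 2 3)"
  proof
    assume "v (transpose 1 2) = v (transpose 2 3)"
    then have "transpose 1 2 = (transpose 2 3 :: nat \<Rightarrow> nat)"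
      by (rule inj_onD[OF inj]) (auto simp: sym_group_carrier intro!: permutes_swap_id)
    then have "transpose 1 2 (1::nat) = transpose 2 3 1" by (rule fun_cong)
    then show False by (simp add: transpose_def)
  qed
  then have "(v \<circ> phi 6) (uvb_elem 6 (Rho 1)) \<noteq> (v \<circ> phi 6) (uvb_elem 6 (Rho 2))"
    by (simp only: gens not_False_eq_True)
  from nonabelian_uvb_hom_cases[OF _ vphi this]
  consider y where "y permutes {1..6}" "\<forall>g\<in>carrier (UVB 6). y \<circ> (v \<circ> phi 6) g \<circ> inv' y = phi 6 g"
    | "v (transpose 1 2) \<in> fpf_involutions 6"
    unfolding gens by auto
  then show ?thesis
  proof cases
    case 1
    have "v p = inv' y \<circ> p \<circ> inv' (inv' y)" if p: "p permutes {1..6}" for p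
    proof -
      obtain g where g: "g \<in> carrier (UVB 6)" "phi 6 g = p" using phi_surj[OF p] by blast
      have "y \<circ> v p \<circ> inv' y = p" using 1(2) g by auto
      then have "p = y \<circ> v p \<circ> inv' y" by simp
      then show ?thesis
        by (simp add: fun_eq_iff permutes_inverses[OF 1(1)] inv_inv_eq permutes_bij[OF 1(1)])
    qed
    then have "inner_automorphism (sym_group 6) v"
      unfolding inner_automorphism_def using permutes_inv[OF 1(1)]
      by (intro bexI[of _ "inv' y"]) (simp_all add: sym_group_carrier sym_group_mult)
    then show ?thesis using outer by blast
  qed
qed

text \<open>If one fixed-point-free involution is mapped to another one, then all of them are, as they are
  conjugate. Since the transposition \<open>(1, 2)\<close> is mapped into the same set, \<open>v\<close> cannot be
  injective.\<close>

lemma outer_automorphism_6_fpf_not_fpf: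
  assumes v: "outer_automorphism (sym_group 6) v"
    and f: "f \<in> fpf_involutions 6"
  shows "v f \<notin> fpf_involutions 6"
proof
  assume vf: "v f \<in> fpf_involutions 6"
  have "v \<in> iso (sym_group 6) (sym_group 6)" using v by (simp add: outer_automorphism_def)
  then have hom: "v \<in> hom (sym_group 6) (sym_group 6)" and inj: "inj_on v (carrier (sym_group 6))"
    by (auto simp: iso_def bij_betw_def)
  let ?F = "fpf_involutions 6"
  have sub: "?F \<subseteq> carrier (sym_group 6)" by (auto simp: fpf_involutions_def sym_group_carrier)
  have "v q \<in> ?F" if q: "q \<in> ?F" for q
  proof -
    obtain y where y: "y permutes {1..6}" "q = y \<circ> f \<circ> inv' y"
      using fpf_involutions_6_conjugate[OF f q] by blast
    have "f permutes {1..6}" using f by (simp add: fpf_involutions_def)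
    then have "v q = v y \<circ> v f \<circ> inv' (v y)"
      unfolding y(2) by (rule hom_sym_group_conjugate[OF hom y(1)])
    moreover have "v y permutes {1..6}"
      using hom_in_carrier[OF hom, of y] y(1) by (simp only: sym_group_carrier)
    ultimately show ?thesis using fpf_involution_conj_closed[OF vf] by simp
  qed
  moreover have tau: "v (transpose 1 2) \<in> ?F" by (rule outer_automorphism_6_transposition_fpf[OF v])
  ultimately have "v ` insert (transpose 1 2) ?F \<subseteq> ?F" by blast
  moreover have "transpose 1 2 \<in> carrier (sym_group 6)"
    by (auto simp: sym_group_carrier intro!: permutes_swap_id)
  then have "inj_on v (insert (transpose 1 2) ?F)" using sub by (intro inj_on_subset[OF inj]) blast
  moreover have fin: "finite ?F"
    by (rule finite_subset[OF _ finite_permutations[of "{1..6::nat}"]]) (auto simp: fpf_involutions_def)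
  ultimately have "card (insert (transpose 1 2) ?F) \<le> card ?F" by (intro card_inj_on_le)
  moreover have "transpose 1 2 \<notin> ?F"
  proof
    assume "transpose 1 2 \<in> ?F"
    then have "\<forall>x\<in>{1..6::nat}. transpose 1 2 x \<noteq> x" unfolding fpf_involutions_def by blast
    then have "transpose 1 2 (3::nat) \<noteq> 3" by (rule bspec) simp
    then show False by simp
  qed
  ultimately show False using fin by simp
qed

theorem theorem1:
  fixes n :: nat and h :: "uvb_gen word set \<Rightarrow> (nat \<Rightarrow> nat)"
  assumes "n \<ge> 5"
    and "h \<in> hom (UVB n) (sym_group n)"
  shows "\<exists>h'. conjugate_homs (UVB n) (sym_group n) h h' \<and>
    ((\<forall>g\<in>carrier (UVB n). h' g = phi n g)
     \<or> abelian_hom (UVB n) (sym_group n) h'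
     \<or> (n = 6 \<and> (\<forall>g\<in>carrier (UVB n). h' g = (v6 \<circ> phi n) g)))"
proof -
  interpret uvb_hom n h using assms by (simp add: uvb_hom_def)
  show ?thesis
  proof (cases "t 1 = t 2")
    case True
    have "conjugate_homs (UVB n) (sym_group n) h h"
      using conjugate_homsI[OF assms(2) permutes_id] by simp
    then show ?thesis using abelian_if_t_agree[OF True] by blast
  next
    case False
    \<comment> \<open>\<open>t 1 \<noteq> t 2\<close>: either \<open>h\<close> is conjugate to \<open>\<phi>\<close>, or the exceptional case of degree 6 occurs.\<close>
    then consider y where "y permutes {1..n}" "\<forall>g\<in>carrier (UVB n). y \<circ> h g \<circ> inv' y = phi n g"
      | "n = 6" "h (uvb_elem n (Rho 1)) \<in> fpf_involutions 6"
      using nonabelian_uvb_hom_cases[OF assms] unfolding t_def by blast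
    then show ?thesis
    proof cases
      case 1
      then show ?thesis using conjugate_homsI[OF assms(2) 1(1)] by blast
    next
      case 2
      have iso: "v6 \<in> iso (sym_group 6) (sym_group 6)" using outer_v6 by (simp add: outer_automorphism_def)
      \<comment> \<open>\<open>u\<close> undoes \<open>v6\<close> on the symmetric group, so that \<open>u \<circ> h\<close> can be classified instead of \<open>h\<close>.\<close>
      define u where "u = inv_into (carrier (sym_group 6)) v6"
      have "u \<in> iso (sym_group 6) (sym_group 6)"
        unfolding u_def by (rule group.iso_set_sym[OF sym_group_is_group iso])
      then have uhom: "u \<in> hom (sym_group 6) (sym_group 6)" by (simp add: iso_def)
      have vhom: "v6 \<in> hom (sym_group 6) (sym_group 6)" using iso by (simp add: iso_def)
      have vu: "v6 (u p) = p" if "p permutes {1..6}" for p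
        using that iso f_inv_into_f[of p v6 "carrier (sym_group 6)"]
        by (simp add: u_def iso_def bij_betw_def sym_group_carrier)
      have h6: "h \<in> hom (UVB 6) (sym_group 6)" using assms(2) 2(1) by simp
      have hc: "h g permutes {1..6}" if "g \<in> carrier (UVB 6)" for g
        using hom_in_carrier[OF h6 that] by (simp only: sym_group_carrier)
      have uh: "u \<circ> h \<in> hom (UVB 6) (sym_group 6)" by (rule hom_compose[OF h6 uhom])
      have t6: "t i = h (uvb_elem 6 (Rho i))" for i
        unfolding t_def by (simp only: 2(1))
      have "t 1 permutes {1..6}" "t 2 permutes {1..6}" using t_permutes[of 1] t_permutes[of 2] 2(1) by simp_all
      then have "u (t 1) \<noteq> u (t 2)" using False vu by metis
      then have ne: "(u \<circ> h) (uvb_elem 6 (Rho 1)) \<noteq> (u \<circ> h) (uvb_elem 6 (Rho 2))"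
        by (simp only: t6 comp_apply not_False_eq_True)
      have "(u \<circ> h) (uvb_elem 6 (Rho 1)) \<notin> fpf_involutions 6"
      proof
        assume "(u \<circ> h) (uvb_elem 6 (Rho 1)) \<in> fpf_involutions 6"
        then have "v6 ((u \<circ> h) (uvb_elem 6 (Rho 1))) \<notin> fpf_involutions 6"
          by (rule outer_automorphism_6_fpf_not_fpf[OF outer_v6])
        moreover have "v6 ((u \<circ> h) (uvb_elem 6 (Rho 1))) = h (uvb_elem 6 (Rho 1))"
          using vu[OF \<open>t 1 permutes {1..6}\<close>] by (simp only: t6 comp_apply)
        ultimately show False using 2 by simp
      qed
      then obtain y where y: "y permutes {1..6}"
        and phi: "\<And>g. g \<in> carrier (UVB 6) \<Longrightarrow> y \<circ> (u \<circ> h) g \<circ> inv' y = phi 6 g"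
        using nonabelian_uvb_hom_cases[OF _ uh ne] by auto
      have vy: "v6 y permutes {1..6}"
        using hom_in_carrier[OF vhom, of y] y by (simp only: sym_group_carrier)
      have "v6 y \<circ> h g \<circ> inv' (v6 y) = (v6 \<circ> phi 6) g" if g: "g \<in> carrier (UVB 6)" for g
      proof -
        have "u (h g) permutes {1..6}"
          using hom_in_carrier[OF uh g] by (simp only: sym_group_carrier comp_apply)
        then have "v6 (phi 6 g) = v6 y \<circ> v6 (u (h g)) \<circ> inv' (v6 y)"
          unfolding phi[OF g, symmetric] comp_apply[of u]
          by (rule hom_sym_group_conjugate[OF vhom y])
        then show ?thesis by (simp add: vu[OF hc[OF g]])
      qed
      then show ?thesis
        using conjugate_homsI[OF h6 vy] 2(1) by blast
    qed
  qed
qed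

end
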